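(* The graph parameter $f(G)=\frac{1}{v(G)}\ln \varepsilon(G)$ is estimable for Eulerian graphs (for every $\Delta$, on the class of finite Eulerian graphs of maximum degree at most $\Delta$); that is, if $(G_n)_n$ is a Benjamini--Schramm convergent (in particular, bounded-degree) sequence of finite Eulerian graphs, then the limit $$\lim_{n\to\infty}\frac{1}{v(G_n)}\ln \varepsilon(G_n)$$ exists.
   Context: All graphs $G_n$ are finite (with at least one vertex), and $v(G)$ denotes the number of vertices of $G$. A graph is called Eulerian if every vertex has even degree (connectedness is not required). An Eulerian orientation of $G$ is an orientation of all edges of $G$ such that at every vertex the in-degree equals the out-degree; $\varepsilon(G)$ denotes the number of Eulerian orientations of $G$ (it is a classical fact that $\varepsilon(G)\ge 1$ for Eulerian $G$). A graph sequence $(G_n)_n$ is bounded-degree if there is a $\Delta$ such that the maximum degree of every $G_n$ is at most $\Delta$. For a finite graph $G$, a finite connected rooted graph $\alpha$ and a positive integer $r$, let $\mathbb{P}(G,\alpha,r)$ be the probability that the $r$-ball centered at a uniformly random vertex of $G$ (rooted at that vertex) is isomorphic, as a rooted graph, to $\alpha$. A bounded-degree graph sequence $(G_n)_n$ is Benjamini--Schramm convergent if for all finite connected rooted graphs $\alpha$ and all integers $r>0$ the sequence $\mathbb{P}(G_n,\alpha,r)$ converges as $n\to\infty$. For a vertex $v$ of $G$ let $B_r(v)$ denote its neighborhood of radius $r$ as a rooted graph, and let $\mathbb{B}_r$ denote the set of all possible $r$-neighborhoods, i.e. rooted graphs of radius at most $r$ (up to isomorphism). A bounded graph parameter $f$ on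 a class of bounded-degree graphs is called estimable if for every $\delta>0$ there are positive integers $k$ and $r$ and a function $g:\mathbb{B}_r^k\to\mathbb{R}$ such that for every graph $G$ in the class and uniform, independently chosen random vertices $v_1,\dots,v_k\in V(G)$ we have $\mathbb{P}(|f(G)-g(B_r(v_1),\dots,B_r(v_k))|>\delta)\le\delta$. By a theorem of Elek, estimability is equivalent to convergence of $(f(G_n))_n$ for every Benjamini--Schramm convergent sequence $(G_n)_n$ in the class; the phrase "that is" in the claim refers to this equivalence. *)

theory Defs
  imports "HOL-Probability.Probability" "Graph_Theory.Graph_Theory"
begin

text \<open>
  A simple undirected graph is a \<^locale>\<open>pair_graph\<close> of the library: a finite, loop-free digraph
  without parallel arcs whose arc relation is symmetric. The edge \<open>{u, v}\<close> is represented by the two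
  arcs \<open>(u, v)\<close> and \<open>(v, u)\<close>, so that the degree of a vertex is its out-degree.
\<close>

definition finite_graph :: "'a pair_pre_digraph \<Rightarrow> bool" where
  "finite_graph G \<longleftrightarrow> pair_graph G \<and> pverts G \<noteq> {}"

definition max_degree_le :: "nat \<Rightarrow> 'a pair_pre_digraph \<Rightarrow> bool" where
  "max_degree_le \<Delta> G \<longleftrightarrow> (\<forall>v \<in> pverts G. out_degree (with_proj G) v \<le> \<Delta>)"

definition eulerian_graph :: "'a pair_pre_digraph \<Rightarrow> bool" where
  "eulerian_graph G \<longleftrightarrow>
     finite_graph G \<and> (\<forall>v \<in> pverts G. even (out_degree (with_proj G) v))"

definition orientation :: "'a pair_pre_digraph \<Rightarrow> 'a pair_pre_digraph \<Rightarrow> bool" where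
  "orientation G D \<longleftrightarrow> pverts D = pverts G \<and> parcs D \<subseteq> parcs G \<and>
     (\<forall>(u, v) \<in> parcs G. (u, v) \<in> parcs D \<longleftrightarrow> (v, u) \<notin> parcs D)"

definition eulerian_orientation :: "'a pair_pre_digraph \<Rightarrow> 'a pair_pre_digraph \<Rightarrow> bool" where
  "eulerian_orientation G D \<longleftrightarrow> orientation G D \<and>
     (\<forall>v \<in> pverts G. in_degree (with_proj D) v = out_degree (with_proj D) v)"

definition num_eulerian_orientations :: "'a pair_pre_digraph \<Rightarrow> nat" where
  "num_eulerian_orientations G = card {D. eulerian_orientation G D}"

type_synonym 'a rooted_graph = "'a pair_pre_digraph \<times> 'a"

definition rooted_iso :: "'a rooted_graph \<Rightarrow> 'b rooted_graph \<Rightarrow> bool" where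
  "rooted_iso A B \<longleftrightarrow>
     (\<exists>h. pre_digraph.digraph_isomorphism (with_proj (fst A)) h \<and>
          with_proj (fst B) = app_iso h (with_proj (fst A)) \<and>
          snd B = iso_verts h (snd A))"

definition finite_connected_rooted_graph :: "'a rooted_graph \<Rightarrow> bool" where
  "finite_connected_rooted_graph A \<longleftrightarrow>
     finite_graph (fst A) \<and> Digraph_Component.connected (with_proj (fst A)) \<and>
     snd A \<in> pverts (fst A)"

definition ball_verts :: "'a pair_pre_digraph \<Rightarrow> nat \<Rightarrow> 'a \<Rightarrow> 'a set" where
  "ball_verts G r v = {u. \<exists>p. pre_digraph.awalk (with_proj G) v p u \<and> length p \<le> r}"

definition rooted_ball :: "'a pair_pre_digraph \<Rightarrow> nat \<Rightarrow> 'a \<Rightarrow> 'a rooted_graph" where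
  "rooted_ball G r v =
     (\<lparr>pverts = ball_verts G r v,
       parcs = parcs G \<inter> ball_verts G r v \<times> ball_verts G r v\<rparr>, v)"

definition ball_prob :: "'a pair_pre_digraph \<Rightarrow> 'b rooted_graph \<Rightarrow> nat \<Rightarrow> real" where
  "ball_prob G A r =
     measure_pmf.prob (pmf_of_set (pverts G)) {v. rooted_iso (rooted_ball G r v) A}"

definition bounded_degree_seq :: "(nat \<Rightarrow> 'a pair_pre_digraph) \<Rightarrow> bool" where
  "bounded_degree_seq G \<longleftrightarrow> (\<exists>\<Delta>. \<forall>n. max_degree_le \<Delta> (G n))"

text \<open>
  Every finite graph is isomorphic to one on natural numbers, so the test graphs \<open>A\<close> range over all
  isomorphism types of finite connected rooted graphs.
\<close>

definition BS_convergent :: "(nat \<Rightarrow> 'a pair_pre_digraph) \<Rightarrow> bool" where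
  "BS_convergent G \<longleftrightarrow> (\<forall>n. finite_graph (G n)) \<and> bounded_degree_seq G \<and>
     (\<forall>A :: nat rooted_graph. \<forall>r > 0.
        finite_connected_rooted_graph A \<longrightarrow> convergent (\<lambda>n. ball_prob (G n) A r))"

text \<open>
  The isomorphism type of a ball, encoded as the set of all its isomorphic copies on natural numbers;
  it lives in the same type for all graphs, whatever their vertex type.
\<close>

definition ball_type :: "'a pair_pre_digraph \<Rightarrow> nat \<Rightarrow> 'a \<Rightarrow> nat rooted_graph set" where
  "ball_type G r v = {A. rooted_iso (rooted_ball G r v) A}"

text \<open>
  A map \<open>\<BB>\<^sub>r\<^sup>k \<Rightarrow> \<real>\<close> is a function \<open>g\<close> on lists of isomorphism types, of which only the values on
  lists of length \<open>k\<close> of types of \<open>r\<close>-balls are used.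
\<close>

definition estimable ::
  "'a pair_pre_digraph set \<Rightarrow> ('a pair_pre_digraph \<Rightarrow> real) \<Rightarrow> bool" where
  "estimable \<C> f \<longleftrightarrow> (\<exists>B. \<forall>G \<in> \<C>. \<bar>f G\<bar> \<le> B) \<and>
     (\<forall>\<delta> > 0. \<exists>k > 0. \<exists>r > 0. \<exists>g :: nat rooted_graph set list \<Rightarrow> real. \<forall>G \<in> \<C>.
        measure_pmf.prob (replicate_pmf k (pmf_of_set (pverts G)))
          {vs. \<bar>f G - g (map (ball_type G r) vs)\<bar> > \<delta>} \<le> \<delta>)"

definition eulerian_entropy :: "'a pair_pre_digraph \<Rightarrow> real" where
  "eulerian_entropy G = ln (real (num_eulerian_orientations G)) / real (card (pverts G))"

end

theory Submission
  imports Defs "HOL-Complex_Analysis.Complex_Analysis"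
begin

text \<open>
  Write every edge constraint of an orientation as \<open>(1 - \<sigma> \<sigma>') / 2\<close>, where \<open>\<sigma>\<close> and \<open>\<sigma>'\<close> are the signs of its two
  half-edges, and expand. Summing over the balanced signs at each vertex turns the number of Eulerian orientations,
  up to a power of two, into the value at \<open>t = 1\<close> of a partition function \<open>F\<close> over edge subsets; its vertex weights
  are central Krawtchouk numbers, whose signs cancel those of the edges, so \<open>F\<close> has nonnegative coefficients. Hence
  replacing \<open>t = 1\<close> by \<open>t = z < 1\<close> changes \<open>ln F\<close> by at most a multiple of \<open>ln (1 / z)\<close> per edge.

  The elementary symmetric polynomials are stable, and Asano contraction of the half-edges shows that \<open>F\<close> has no
  zeros in the open unit disc, even with different weights on the edges. So the edge marginals \<open>N / F\<close> are analytic
  and bounded on smaller discs, uniformly in the graph. Exchanging components in a pair of edge subsets shows that the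
  marginal in the graph and the one in a ball of radius \<open>r\<close> agree to order \<open>r\<close> at \<open>0\<close>; by the maximum
  principle they are exponentially close on \<open>[0, z]\<close>. Integrating the logarithmic derivative, \<open>ln F z\<close> is
  approximated by a sum over the vertices of a function of the isomorphism type of their balls.
\<close>

section \<open>Symmetric sets of arcs\<close>

text \<open>The obstacle is that \<open>t = 1\<close> lies on the boundary of the zero-free disc, so
  locality is available only at \<open>z < 1\<close>. The step from \<open>z\<close> to 1 needs
  another argument, namely positivity of the coefficients, and positivity comes from the even
  degrees of \<open>G\<close>. A ball in \<open>G\<close> is in general not Eulerian, since the
  vertices of its outermost layer may lose edges. For this reason the weights are complex and are
  defined with \<open>d div 2\<close> for all degrees, and zero-freeness, the bound on the marginals
  and the exchange argument are stated for arbitrary finite simple graphs. Logarithms of the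
  partition function are taken for the Eulerian graph alone. Separate edge weights serve the bound
  on the marginals: rescaling a single edge gives an estimate that depends neither on the graph nor
  on its degrees. Arcs play the half-edges throughout, so an edge subset is a symmetric set of
  arcs.\<close>

lemma sym_irrefl_induct [consumes 3, case_names empty insert]:
  assumes "finite S" "sym S" "irrefl S"
    and empty: "P {}"
    and insert: "\<And>S a b. finite S \<Longrightarrow> sym S \<Longrightarrow> irrefl S \<Longrightarrow> a \<noteq> b \<Longrightarrow> (a, b) \<notin> S \<Longrightarrow> (b, a) \<notin> S \<Longrightarrow>
      P S \<Longrightarrow> P (insert (a, b) (insert (b, a) S))"
  shows "P S"
  using assms(1-3)
proof (induction "card S" arbitrary: S rule: less_induct)
  case less
  show ?case
  proof (cases "S = {}")
    case True
    then show ?thesis using empty by simp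
  next
    case False
    then obtain a b where ab: "(a, b) \<in> S" by auto
    then have ba: "(b, a) \<in> S" and ne: "a \<noteq> b"
      using less.prems by (auto dest: symD simp: irrefl_def)
    define T where "T = S - {(a, b), (b, a)}"
    have S: "S = insert (a, b) (insert (b, a) T)" using ab ba by (auto simp: T_def)
    have "card T < card S"
      using ab less.prems(1) by (intro psubset_card_mono) (auto simp: T_def)
    moreover have "finite T" "sym T" "irrefl T"
      using less.prems by (auto simp: T_def sym_def irrefl_def)
    ultimately have "P T" using less.hyps by blast
    then show ?thesis
      unfolding S using \<open>finite T\<close> \<open>sym T\<close> \<open>irrefl T\<close> ne by (intro insert) (auto simp: T_def)
  qed
qed

lemma sym_insert2_iff:
  assumes "(a, b) \<notin> X" "(b, a) \<notin> X"
  shows "sym (insert (a, b) (insert (b, a) X)) \<longleftrightarrow> sym X"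
proof
  assume sym: "sym (insert (a, b) (insert (b, a) X))"
  show "sym X"
  proof (rule symI)
    fix x y assume xy: "(x, y) \<in> X"
    then have "(y, x) \<in> insert (a, b) (insert (b, a) X)" using symD[OF sym] by blast
    then show "(y, x) \<in> X" using xy assms by blast
  qed
qed (auto simp: sym_def)

text \<open>For the arc set \<open>S\<close> of a graph these are the edge subsets: an edge is
  present with both of its arcs or absent.\<close>

definition symsub :: "'a rel \<Rightarrow> 'a rel set" where
  "symsub S = {A. A \<subseteq> S \<and> sym A}"

lemma finite_symsub [simp]: "finite S \<Longrightarrow> finite (symsub S)"
  by (rule finite_subset[of _ "Pow S"]) (auto simp: symsub_def)

lemma empty_in_symsub [simp]: "{} \<in> symsub S"
  by (auto simp: symsub_def sym_def)

lemma prod_insert2: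
  fixes g :: "'b \<Rightarrow> 'c::comm_monoid_mult"
  assumes "finite A" "p \<notin> A" "q \<notin> A" "p \<noteq> q"
  shows "prod g (insert p (insert q A)) = g p * g q * prod g A"
  using assms by (simp add: mult.assoc)

text \<open>A symmetric subset contains both arcs of the new edge or none of them, which gives the
  two summands of the factor.\<close>

lemma sum_symsub_prod_insert:
  fixes g :: "'a \<times> 'a \<Rightarrow> 'c::comm_ring_1"
  assumes "finite S" "sym S" "a \<noteq> b" "(a, b) \<notin> S" "(b, a) \<notin> S"
  shows "(\<Sum>A\<in>symsub (insert (a, b) (insert (b, a) S)). \<Prod>e\<in>A. g e) =
    (1 + g (a, b) * g (b, a)) * (\<Sum>A\<in>symsub S. \<Prod>e\<in>A. g e)"
proof -
  let ?f = "\<lambda>A. insert (a, b) (insert (b, a) A)"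
  have eq: "symsub (?f S) = symsub S \<union> ?f ` symsub S"
  proof (intro equalityI subsetI)
    fix A assume A: "A \<in> symsub (?f S)"
    show "A \<in> symsub S \<union> ?f ` symsub S"
    proof (cases "(a, b) \<in> A")
      case True
      then have "(b, a) \<in> A" using A by (auto simp: symsub_def dest: symD)
      then have "A = ?f (A - {(a, b), (b, a)})" using True by auto
      moreover have "A - {(a, b), (b, a)} \<in> symsub S"
        using A by (auto simp: symsub_def sym_def)
      ultimately show ?thesis by blast
    next
      case False
      then have "(b, a) \<notin> A" using A by (auto simp: symsub_def dest: symD)
      then show ?thesis using False A by (auto simp: symsub_def)
    qed
  qed (auto simp: symsub_def sym_def)
  have disj: "symsub S \<inter> ?f ` symsub S = {}"
    using assms by (auto simp: symsub_def)
  have inj: "inj_on ?f (symsub S)"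
  proof (rule inj_onI)
    fix A B assume "A \<in> symsub S" "B \<in> symsub S" and e: "?f A = ?f B"
    then have "(a, b) \<notin> A" "(b, a) \<notin> A" "(a, b) \<notin> B" "(b, a) \<notin> B"
      using assms by (auto simp: symsub_def)
    then show "A = B" using e assms(3) by (metis insert_ident insertE prod.inject)
  qed
  have "(\<Sum>A\<in>?f ` symsub S. \<Prod>e\<in>A. g e) = (\<Sum>A\<in>symsub S. \<Prod>e\<in>?f A. g e)"
    by (simp add: sum.reindex[OF inj])
  also have "\<dots> = (\<Sum>A\<in>symsub S. g (a, b) * g (b, a) * (\<Prod>e\<in>A. g e))"
  proof (rule sum.cong[OF refl], rule prod_insert2)
    fix A assume "A \<in> symsub S"
    then have "A \<subseteq> S" by (simp add: symsub_def)
    then show "finite A" "(a, b) \<notin> A" "(b, a) \<notin> A" "(a, b) \<noteq> (b, a)"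
      using assms finite_subset by auto
  qed
  finally have "(\<Sum>A\<in>?f ` symsub S. \<Prod>e\<in>A. g e) = \<dots>" .
  then show ?thesis
    unfolding eq using assms(1) disj
    by (subst sum.union_disjoint) (auto simp: algebra_simps sum_distrib_left)
qed

section \<open>Asano contraction\<close>

text \<open>The product of the two roots is \<open>A / D\<close>, so they cannot both have norm at
  least 1.\<close>

lemma quadratic_root_norm_less_1:
  fixes A B D :: complex
  assumes "D \<noteq> 0" "norm (A / D) < 1"
  obtains r where "A + B * r + D * r\<^sup>2 = 0" "norm r < 1"
proof -
  define s where "s = csqrt (B\<^sup>2 - 4 * A * D)"
  have s2: "s\<^sup>2 = B\<^sup>2 - 4 * A * D" by (simp add: s_def)
  define r1 where "r1 = (- B + s) / (2 * D)"
  define r2 where "r2 = (- B - s) / (2 * D)"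
  have "r1 * r2 = (B\<^sup>2 - s\<^sup>2) / (4 * D\<^sup>2)"
    using assms(1) by (simp add: r1_def r2_def field_simps power2_eq_square)
  also have "\<dots> = A / D" unfolding s2 using assms(1) by (simp add: field_simps power2_eq_square)
  finally have prod: "r1 * r2 = A / D" .
  have root: "A + B * r + D * r\<^sup>2 = 0" if "r = (- B + s') / (2 * D)" "s'\<^sup>2 = B\<^sup>2 - 4 * A * D" for r s'
  proof -
    have "4 * D * (A + B * r + D * r\<^sup>2) = (2 * D * r + B)\<^sup>2 - (B\<^sup>2 - 4 * A * D)"
      by (simp add: power2_eq_square algebra_simps)
    also have "2 * D * r + B = s'" using assms(1) that(1) by simp
    finally show ?thesis using assms(1) that(2) by simp
  qed
  have "A + B * r1 + D * r1\<^sup>2 = 0" by (rule root[of _ s]) (simp_all add: r1_def s2)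
  moreover have "A + B * r2 + D * r2\<^sup>2 = 0" by (rule root[of _ "- s"]) (simp_all add: r2_def s2)
  moreover have "norm r1 < 1 \<or> norm r2 < 1"
  proof (rule ccontr)
    assume "\<not> (norm r1 < 1 \<or> norm r2 < 1)"
    then have "1 * 1 \<le> norm r1 * norm r2" by (intro mult_mono) auto
    then show False using assms(2) prod by (simp add: norm_mult[symmetric])
  qed
  ultimately show thesis using that by blast
qed

text \<open>On the diagonal \<open>s = t\<close> the polynomial is a quadratic. If
  \<open>A + D * w\<close> vanished, the product of its roots would be \<open>- w\<close>, and one
  root would lie in the open disc.\<close>

lemma Asano_contraction:
  fixes A B C D w :: complex
  assumes nz: "\<And>s t. norm s < 1 \<Longrightarrow> norm t < 1 \<Longrightarrow> A + B * s + C * t + D * (s * t) \<noteq> 0"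
    and w: "norm w < 1"
  shows "A + D * w \<noteq> 0"
proof
  assume eq: "A + D * w = 0"
  have "A \<noteq> 0" using nz[of 0 0] by simp
  then have D: "D \<noteq> 0" using eq by auto
  then have "A / D = - w" using eq by (simp add: field_simps add_eq_0_iff)
  then obtain r where r: "A + (B + C) * r + D * r\<^sup>2 = 0" "norm r < 1"
    using quadratic_root_norm_less_1[of D A "B + C"] D w by auto
  then show False using nz[of r r] by (simp add: algebra_simps power2_eq_square)
qed


lemma sum_Pow_insert:
  fixes f :: "'b set \<Rightarrow> 'c::comm_monoid_add"
  assumes "finite S" "p \<notin> S"
  shows "(\<Sum>B\<in>Pow (insert p S). f B) = (\<Sum>B\<in>Pow S. f B + f (insert p B))"
proof -
  have "(\<Sum>B\<in>Pow (insert p S). f B) = (\<Sum>B\<in>Pow S. f B) + (\<Sum>B\<in>insert p ` Pow S. f B)"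
    using assms by (subst Pow_insert, subst sum.union_disjoint) auto
  also have "(\<Sum>B\<in>insert p ` Pow S. f B) = (\<Sum>B\<in>Pow S. f (insert p B))"
    using assms by (subst sum.reindex) (auto simp: inj_on_def)
  finally show ?thesis by (simp add: sum.distrib)
qed

text \<open>One application of \<open>Asano_contraction\<close> for each edge. The set
  \<open>U\<close> collects the arcs whose edges are already contracted; among these, only subsets
  with both arcs of an edge or neither survive.\<close>

lemma Asano_contraction_symmetric:
  fixes c :: "'a rel \<Rightarrow> complex"
  assumes nz: "\<And>y. (\<And>e. norm (y e) < 1) \<Longrightarrow> (\<Sum>B\<in>Pow S. c B * prod y B) \<noteq> 0"
    and S: "finite S"
    and U: "finite U" "sym U" "irrefl U"
    and "U \<subseteq> S"
    and "\<And>e. norm (y e) < 1"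
  shows "(\<Sum>B\<in>Pow S. if sym (B \<inter> U) then c B * prod y B else 0) \<noteq> 0"
  using U assms(6-)
proof (induction U arbitrary: y rule: sym_irrefl_induct)
  case empty
  then show ?case using nz by (simp add: sym_def)
next
  case (insert U a b)
  define p q where "p = (a, b)" and "q = (b, a)"
  have pq: "p \<noteq> q" "p \<notin> U" "q \<notin> U" "p \<in> S" "q \<in> S"
    using insert by (auto simp: p_def q_def)
  define T where "T = S - {p, q}"
  have T: "finite T" "p \<notin> T" "q \<notin> T" "S = insert p (insert q T)"
    using S pq by (auto simp: T_def)
  \<comment> \<open>Sorting the subsets by whether they contain \<open>p\<close> and
    \<open>q\<close> gives the four coefficients of a polynomial that is affine in each of the two
    variables of the new edge.\<close>
  define A where "A = (\<Sum>B\<in>Pow T. if sym (B \<inter> U) then c B * prod y B else 0)"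
  define A1 where "A1 = (\<Sum>B\<in>Pow T. if sym (B \<inter> U) then c (insert p B) * prod y B else 0)"
  define A2 where "A2 = (\<Sum>B\<in>Pow T. if sym (B \<inter> U) then c (insert q B) * prod y B else 0)"
  define D where "D = (\<Sum>B\<in>Pow T. if sym (B \<inter> U) then c (insert p (insert q B)) * prod y B else 0)"
  have split: "(\<Sum>B\<in>Pow S. f B) =
      (\<Sum>B\<in>Pow T. f B + f (insert p B) + f (insert q B) + f (insert p (insert q B)))"
    for f :: "'a rel \<Rightarrow> complex"
  proof -
    have "(\<Sum>B\<in>Pow S. f B) = (\<Sum>B\<in>Pow (insert q T). f B + f (insert p B))"
      using T(1-3) pq(1) unfolding T(4) by (intro sum_Pow_insert) auto
    also have "\<dots> = (\<Sum>B\<in>Pow T. f B + f (insert p B) + (f (insert q B) + f (insert p (insert q B))))"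
      using T(1-3) by (intro sum_Pow_insert) auto
    finally show ?thesis by (simp only: add.assoc)
  qed
  have prod_upd: "prod (y(p := s, q := t)) B = prod y B" if "B \<in> Pow T" for s t B
    using that T(2,3) by (intro prod.cong) auto
  have prods: "prod f (insert p B) = f p * prod f B" "prod f (insert q B) = f q * prod f B"
    "prod f (insert p (insert q B)) = f p * f q * prod f B"
    if "B \<in> Pow T" for B and f :: "'a \<times> 'a \<Rightarrow> complex"
  proof -
    have "finite B" "p \<notin> B" "q \<notin> B" using that T(1-3) finite_subset[of B T] by auto
    then show "prod f (insert p B) = f p * prod f B" "prod f (insert q B) = f q * prod f B"
      "prod f (insert p (insert q B)) = f p * f q * prod f B"
      using pq(1) prod_insert2 by simp_all
  qed
  have int: "insert p B \<inter> U = B \<inter> U" "insert q B \<inter> U = B \<inter> U" for B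
    using pq by auto
  have "A + A1 * s + A2 * t + D * (s * t) \<noteq> 0" if "norm s < 1" "norm t < 1" for s t
  proof -
    define y' where "y' = y(p := s, q := t)"
    have y': "y' p = s" "y' q = t" "\<And>B. B \<in> Pow T \<Longrightarrow> prod y' B = prod y B"
      using prod_upd pq(1) by (auto simp: y'_def)
    have "(\<Sum>B\<in>Pow S. if sym (B \<inter> U) then c B * prod y' B else 0) \<noteq> 0"
      using insert.prems that by (intro insert.IH[of y']) (auto simp: y'_def)
    moreover have "(\<Sum>B\<in>Pow S. if sym (B \<inter> U) then c B * prod y' B else 0) =
        A + A1 * s + A2 * t + D * (s * t)"
      by (simp only: A_def A1_def A2_def D_def split int sum_distrib_right sum.distrib[symmetric])
        (rule sum.cong[OF refl], simp add: prods y' algebra_simps)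
    ultimately show ?thesis by simp
  qed
  \<comment> \<open>The contracted variable is specialised to \<open>y p * y q\<close>, so that the
    result is again a sum of terms \<open>prod y B\<close>.\<close>
  moreover have "norm (y p) * norm (y q) < 1 * 1"
    using insert.prems by (intro mult_strict_mono) auto
  then have "norm (y p * y q) < 1" by (simp add: norm_mult)
  ultimately have "A + D * (y p * y q) \<noteq> 0" by (intro Asano_contraction[of A A1 A2 D]) auto
  moreover have "A + D * (y p * y q) =
      (\<Sum>B\<in>Pow S. if sym (B \<inter> insert p (insert q U)) then c B * prod y B else 0)"
  proof -
    have 1: "sym (B \<inter> insert p (insert q U)) \<longleftrightarrow> sym (B \<inter> U)" if "B \<in> Pow T" for B
    proof -
      have "B \<inter> insert p (insert q U) = B \<inter> U" using that T by auto
      then show ?thesis by simp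
    qed
    have 2: "\<not> sym (insert p B \<inter> insert p (insert q U))"
      "\<not> sym (insert q B \<inter> insert p (insert q U))" if "B \<in> Pow T" for B
    proof -
      have "q \<notin> insert p B" "p \<notin> insert q B" using that T pq(1) by auto
      then show "\<not> sym (insert p B \<inter> insert p (insert q U))"
        "\<not> sym (insert q B \<inter> insert p (insert q U))"
        unfolding p_def q_def by (blast dest: symD)+
    qed
    have 3: "sym (insert p (insert q B) \<inter> insert p (insert q U)) \<longleftrightarrow> sym (B \<inter> U)" if "B \<in> Pow T" for B
    proof -
      have "insert p (insert q B) \<inter> insert p (insert q U) = insert p (insert q (B \<inter> U))" using that T by auto
      moreover have "sym (insert p (insert q (B \<inter> U))) \<longleftrightarrow> sym (B \<inter> U)"
        using pq unfolding p_def q_def by (intro sym_insert2_iff) auto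
      ultimately show ?thesis by simp
    qed
    show ?thesis
      by (simp only: A_def D_def split sum_distrib_right sum.distrib[symmetric])
        (rule sum.cong[OF refl], simp only: prods 1 2 3 if_False add_0_right, simp add: algebra_simps)
  qed
  ultimately show ?case by (simp add: p_def q_def)
qed

section \<open>Stability of the elementary symmetric polynomials\<close>

definition esym :: "nat \<Rightarrow> ('b \<Rightarrow> 'c::comm_semiring_1) \<Rightarrow> 'b set \<Rightarrow> 'c" where
  "esym k x S = (\<Sum>X | X \<subseteq> S \<and> card X = k. \<Prod>a\<in>X. x a)"

lemma esym_conv_Pow: "finite S \<Longrightarrow> esym k x S = (\<Sum>X\<in>Pow S. if card X = k then prod x X else 0)"
  unfolding esym_def by (intro sum.mono_neutral_cong_left) auto

lemma esym_0: "finite S \<Longrightarrow> esym 0 x S = 1"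
proof -
  assume "finite S"
  then have "{X. X \<subseteq> S \<and> card X = 0} = {{}}" by (auto dest: finite_subset)
  then show ?thesis by (simp add: esym_def)
qed

lemma esym_Suc_empty: "esym (Suc k) x {} = 0"
  by (simp add: esym_conv_Pow)

lemma esym_Suc_insert:
  assumes "finite S" "a \<notin> S"
  shows "esym (Suc k) x (insert a S) = esym (Suc k) x S + x a * esym k x S"
proof -
  have "X \<in> Pow S \<Longrightarrow> card (insert a X) = Suc (card X) \<and> prod x (insert a X) = x a * prod x X" for X
    using assms finite_subset[of X S] in_mono[of X S a] by auto
  then show ?thesis
    using assms by (auto simp: esym_conv_Pow sum_Pow_insert sum.distrib sum_distrib_left
        intro!: sum.cong arg_cong2[where f = "(+)"])
qed

text \<open>Euler's identity for a homogeneous polynomial of degree \<open>Suc k\<close>: the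
  partial derivative in the variable \<open>x a\<close> is
  \<open>esym k x (S - {a})\<close>.\<close>

lemma esym_Euler:
  assumes "finite S"
  shows "of_nat (Suc k) * esym (Suc k) x S = (\<Sum>a\<in>S. x a * esym k x (S - {a}))"
  using assms
proof (induction S arbitrary: k rule: finite_induct)
  case empty
  then show ?case by (simp add: esym_Suc_empty)
next
  case (insert b S)
  have diff: "insert b S - {a} = insert b (S - {a})" if "a \<in> S" for a
    using that insert by auto
  show ?case
  proof (cases k)
    case 0
    then show ?thesis
      using insert by (simp add: esym_0 esym_Suc_insert)
        (use insert.IH[of 0] insert in \<open>simp add: esym_0 add.commute\<close>)
  next
    case (Suc j)
    have "(\<Sum>a\<in>insert b S. x a * esym k x (insert b S - {a})) =
        x b * esym k x S + (\<Sum>a\<in>S. x a * (esym k x (S - {a}) + x b * esym j x (S - {a})))"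
      using insert by (simp add: diff Suc esym_Suc_insert)
    also have "\<dots> = x b * esym k x S + (\<Sum>a\<in>S. x a * esym k x (S - {a})) +
        x b * (\<Sum>a\<in>S. x a * esym j x (S - {a}))"
      by (simp add: algebra_simps sum.distrib sum_distrib_left)
    also have "\<dots> = of_nat (Suc k) * esym (Suc k) x (insert b S)"
      using insert.IH[of k] insert.IH[of j] insert.hyps by (simp add: esym_Suc_insert Suc algebra_simps)
    finally show ?thesis by simp
  qed
qed

lemma Re_divide_pos_iff: "Re (1 / z) > 0 \<longleftrightarrow> Re z > 0"
  by (auto simp: Re_divide zero_less_divide_iff sum_power2_gt_zero_iff not_sum_power2_lt_zero)

text \<open>
  Euler's identity writes the ratio of consecutive elementary symmetric polynomials as a positive combination of
  terms \<open>1 / (1 / x a + 1 / q)\<close>, where \<open>q\<close> is such a ratio with one variable less.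
\<close>

lemma esym_stable:
  fixes x :: "'b \<Rightarrow> complex"
  assumes "finite S" "Suc k \<le> card S" "\<And>a. a \<in> S \<Longrightarrow> Re (x a) > 0"
  shows "esym k x S \<noteq> 0 \<and> Re (esym (Suc k) x S / esym k x S) > 0"
  using assms
proof (induction k arbitrary: S)
  case 0
  have "esym (Suc 0) x S = (\<Sum>a\<in>S. x a)"
    using esym_Euler[OF 0(1), of 0 x] 0(1) by (simp add: esym_0)
  moreover have "S \<noteq> {}" using 0 by auto
  ultimately show ?case using 0 by (auto simp: esym_0 intro!: sum_pos)
next
  case (Suc k)
  have IH: "esym k x S \<noteq> 0" "Re (esym (Suc k) x S / esym k x S) > 0"
    using Suc.IH[of S] Suc.prems by auto
  then have nz: "esym (Suc k) x S \<noteq> 0" by auto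
  have pos: "Re (x a * esym (Suc k) x (S - {a}) / esym (Suc k) x S) > 0" if a: "a \<in> S" for a
  proof -
    have "finite (S - {a})" "Suc k \<le> card (S - {a})" using Suc.prems a by auto
    then have IHa: "esym k x (S - {a}) \<noteq> 0" "Re (esym (Suc k) x (S - {a}) / esym k x (S - {a})) > 0"
      using Suc.IH[of "S - {a}"] Suc.prems(3) by auto
    have nz': "esym (Suc k) x (S - {a}) \<noteq> 0" using IHa by auto
    have xa: "Re (x a) > 0" "x a \<noteq> 0" using Suc.prems(3)[OF a] by auto
    have "esym (Suc k) x (insert a (S - {a})) = esym (Suc k) x (S - {a}) + x a * esym k x (S - {a})"
      using Suc.prems by (intro esym_Suc_insert) auto
    then have S: "esym (Suc k) x S = esym (Suc k) x (S - {a}) + x a * esym k x (S - {a})"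
      using a by (simp add: insert_absorb)
    have "x a * esym (Suc k) x (S - {a}) / esym (Suc k) x S =
        1 / (1 / x a + 1 / (esym (Suc k) x (S - {a}) / esym k x (S - {a})))"
      using xa nz' IHa(1) nz S by (simp add: field_simps)
    moreover have "Re (1 / x a + 1 / (esym (Suc k) x (S - {a}) / esym k x (S - {a}))) > 0"
      using xa IHa(2) 
      by (simp only: plus_complex.sel Re_divide_pos_iff add_pos_pos)
    ultimately show ?thesis by (simp only: Re_divide_pos_iff)
  qed
  have "of_nat (Suc (Suc k)) * (esym (Suc (Suc k)) x S / esym (Suc k) x S) =
      (\<Sum>a\<in>S. x a * esym (Suc k) x (S - {a}) / esym (Suc k) x S)"
    using esym_Euler[OF Suc.prems(1), of "Suc k" x] by (simp add: sum_divide_distrib[symmetric])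
  then have "Re (of_nat (Suc (Suc k)) * (esym (Suc (Suc k)) x S / esym (Suc k) x S)) =
      (\<Sum>a\<in>S. Re (x a * esym (Suc k) x (S - {a}) / esym (Suc k) x S))"
    by (simp only: Re_sum)
  moreover have "(\<Sum>a\<in>S. Re (x a * esym (Suc k) x (S - {a}) / esym (Suc k) x S)) > 0"
    using pos Suc.prems by (intro sum_pos) auto
  moreover have "Re (of_nat n * z) = real n * Re z" for n z by simp
  ultimately have "0 < real (Suc (Suc k)) * Re (esym (Suc (Suc k)) x S / esym (Suc k) x S)"
    by (simp only:)
  then show ?case using nz by (simp only: zero_less_mult_iff) auto
qed

lemma esym_nonzero:
  fixes x :: "'b \<Rightarrow> complex"
  assumes "finite S" "k \<le> card S" "\<And>a. a \<in> S \<Longrightarrow> Re (x a) > 0"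
  shows "esym k x S \<noteq> 0"
proof (cases k)
  case (Suc j)
  then show ?thesis using esym_stable[of S j x] assms by auto
qed (use assms in \<open>simp add: esym_0\<close>)

section \<open>Krawtchouk coefficients and vertex polynomials\<close>

text \<open>The value at \<open>k\<close> of the Krawtchouk polynomial of degree \<open>m\<close>
  for length \<open>n\<close>, read off its generating function. Its role here is that of a sum of
  signs over the \<open>m\<close>-subsets of an \<open>n\<close>-set, as in
  \<open>krawtchouk_sum\<close>.\<close>

definition krawtchouk :: "nat \<Rightarrow> nat \<Rightarrow> nat \<Rightarrow> 'c::comm_ring_1" where
  "krawtchouk n m k = coeff ([:1, -1:] ^ k * [:1, 1:] ^ (n - k)) m"

lemma coeff_prod_linear_poly:
  fixes s :: "'b \<Rightarrow> 'c::comm_ring_1"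
  assumes "finite H"
  shows "coeff (\<Prod>a\<in>H. [:1, s a:]) m = esym m s H"
  using assms
proof (induction H arbitrary: m rule: finite_induct)
  case empty
  then show ?case by (cases m) (auto simp: esym_0 esym_Suc_empty)
next
  case (insert a H)
  then show ?case
    by (cases m) (auto simp: esym_0 esym_Suc_insert)
qed

lemma krawtchouk_sum:
  assumes "finite H" "B \<subseteq> H"
  shows "(\<Sum>X | X \<subseteq> H \<and> card X = m. \<Prod>a\<in>B. if a \<in> X then - 1 else 1 :: 'c::comm_ring_1) =
    krawtchouk (card H) m (card B)"
proof -
  define s where "s a = (if a \<in> B then -1 else 1 :: 'c)" for a
  \<comment> \<open>Both products are -1 to the power \<open>card (B \<inter> X)\<close>, which is
    symmetric in \<open>B\<close> and \<open>X\<close>; this turns the sum over \<open>X\<close>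
    into an elementary symmetric polynomial in the signs \<open>s\<close>.\<close>
  have "(\<Prod>a\<in>B. if a \<in> X then -1 else 1 :: 'c) = prod s X" if "X \<subseteq> H" for X
  proof -
    have fin: "finite X" "finite B" using assms that finite_subset by auto
    have "(\<Prod>a\<in>B. if a \<in> X then -1 else 1 :: 'c) = (\<Prod>a\<in>B \<inter> X. -1)"
      using fin by (subst prod.inter_restrict) auto
    also have "\<dots> = prod s X"
      using fin unfolding s_def by (subst Int_commute, subst prod.inter_restrict) auto
    finally show ?thesis .
  qed
  then have "(\<Sum>X | X \<subseteq> H \<and> card X = m. \<Prod>a\<in>B. if a \<in> X then - 1 else 1 :: 'c) = esym m s H"
    by (simp add: esym_def)
  also have "\<dots> = coeff (\<Prod>a\<in>H. [:1, s a:]) m" using assms by (simp add: coeff_prod_linear_poly)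
  also have "(\<Prod>a\<in>H. [:1, s a:]) = (\<Prod>a\<in>B. [:1, s a:]) * (\<Prod>a\<in>H - B. [:1, s a:])"
    using assms by (metis mult.commute prod.subset_diff)
  also have "\<dots> = [:1, -1:] ^ card B * [:1, 1:] ^ card (H - B)"
    by (simp add: s_def)
  also have "card (H - B) = card H - card B" using assms finite_subset card_Diff_subset by metis
  finally show ?thesis by (simp add: krawtchouk_def)
qed

text \<open>Expanding the Krawtchouk numbers and exchanging the sums leaves the product of the
  factors \<open>1 + y a\<close> times an elementary symmetric polynomial in the Cayley transforms
  \<open>(1 - y a) / (1 + y a)\<close>. These lie in the right half-plane, where stability
  applies.\<close>

lemma vertex_poly_nonzero:
  fixes y :: "'b \<Rightarrow> complex"
  assumes "finite H" "m \<le> card H" "\<And>a. norm (y a) < 1"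
  shows "(\<Sum>B\<in>Pow H. krawtchouk (card H) m (card B) * prod y B) \<noteq> 0"
proof -
  let ?\<sigma> = "\<lambda>X a. if a \<in> X then - 1 else 1 :: complex"
  have nz: "1 + y a \<noteq> 0" for a
    using assms(3)[of a] by (auto simp: add_eq_0_iff)
  have "(\<Sum>B\<in>Pow H. krawtchouk (card H) m (card B) * prod y B) =
      (\<Sum>B\<in>Pow H. \<Sum>X | X \<subseteq> H \<and> card X = m. (\<Prod>a\<in>B. ?\<sigma> X a * y a))"
    using assms(1) by (intro sum.cong)
      (auto simp: krawtchouk_sum[symmetric] sum_distrib_right prod.distrib)
  also have "\<dots> = (\<Sum>X | X \<subseteq> H \<and> card X = m. \<Sum>B\<in>Pow H. (\<Prod>a\<in>B. ?\<sigma> X a * y a))"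
    by (rule sum.swap)
  also have "\<dots> = (\<Sum>X | X \<subseteq> H \<and> card X = m. \<Prod>a\<in>H. 1 + ?\<sigma> X a * y a)"
  proof (rule sum.cong[OF refl])
    show "(\<Sum>B\<in>Pow H. \<Prod>a\<in>B. ?\<sigma> X a * y a) = (\<Prod>a\<in>H. 1 + ?\<sigma> X a * y a)" for X
      using prod_add[OF assms(1), of "\<lambda>a. ?\<sigma> X a * y a" "\<lambda>_. 1"]
      by (simp only: prod.neutral_const mult_1_right add.commute)
  qed
  also have "\<dots> = (\<Sum>X | X \<subseteq> H \<and> card X = m. (\<Prod>a\<in>H. 1 + y a) * (\<Prod>a\<in>X. (1 - y a) / (1 + y a)))"
  proof (rule sum.cong[OF refl])
    fix X assume "X \<in> {X. X \<subseteq> H \<and> card X = m}"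
    then have "X \<subseteq> H" by auto
    then have X: "(\<Prod>a\<in>X. (1 - y a) / (1 + y a)) = (\<Prod>a\<in>H. if a \<in> X then (1 - y a) / (1 + y a) else 1)"
      using assms(1) by (simp add: prod.inter_restrict[symmetric] Int_absorb1)
    show "(\<Prod>a\<in>H. 1 + ?\<sigma> X a * y a) = (\<Prod>a\<in>H. 1 + y a) * (\<Prod>a\<in>X. (1 - y a) / (1 + y a))"
      unfolding X prod.distrib[symmetric] using nz by (intro prod.cong) auto
  qed
  also have "\<dots> = (\<Prod>a\<in>H. 1 + y a) * esym m (\<lambda>a. (1 - y a) / (1 + y a)) H"
    by (simp add: esym_def sum_distrib_left)
  also have "\<dots> \<noteq> 0"
  proof -
    have "Re ((1 - y a) / (1 + y a)) > 0" for a
    proof -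
      have "(norm (y a))\<^sup>2 < 1" using assms(3)[of a] by (simp add: abs_square_less_1)
      then have "(Re (y a))\<^sup>2 + (Im (y a))\<^sup>2 < 1" by (simp add: cmod_power2)
      moreover have "Re (1 + y a) \<noteq> 0"
        using assms(3)[of a] abs_Re_le_cmod[of "y a"] by auto
      then have "0 < (1 + Re (y a))\<^sup>2 + (Im (y a))\<^sup>2" by (simp add: add_pos_nonneg)
      ultimately show ?thesis
        by (simp add: Re_divide zero_less_divide_iff power2_eq_square algebra_simps)
    qed
    then show ?thesis using assms nz by (simp add: esym_nonzero)
  qed
  finally show ?thesis .
qed

section \<open>Zero-freeness\<close>

definition outs :: "'a rel \<Rightarrow> 'a \<Rightarrow> 'a rel" where
  "outs A v = {e \<in> A. fst e = v}"

lemma outs_subset: "outs A v \<subseteq> A" by (auto simp: outs_def)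

lemma outs_mono: "A \<subseteq> B \<Longrightarrow> outs A v \<subseteq> outs B v" by (auto simp: outs_def)

lemma finite_outs [simp]: "finite A \<Longrightarrow> finite (outs A v)" by (auto simp: outs_def)

lemma prod_outs:
  fixes y :: "'a \<times> 'a \<Rightarrow> 'c::comm_monoid_mult"
  assumes "finite V" "finite A" "fst ` A \<subseteq> V"
  shows "prod y A = (\<Prod>v\<in>V. prod y (outs A v))"
  using prod.group[OF assms(2,1,3), of y] by (simp add: outs_def)

lemma sum_outs:
  fixes y :: "'a \<times> 'a \<Rightarrow> 'c::comm_monoid_add"
  assumes "finite V" "finite A" "fst ` A \<subseteq> V"
  shows "sum y A = (\<Sum>v\<in>V. sum y (outs A v))"
  using sum.group[OF assms(2,1,3), of y] by (simp add: outs_def)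

text \<open>The stars \<open>outs S v\<close> partition \<open>S\<close>, so choosing a subset of
  \<open>S\<close> amounts to choosing a subset of each star independently.\<close>

lemma sum_Pow_prod_outs:
  fixes f :: "'a \<Rightarrow> 'a rel \<Rightarrow> 'c::comm_semiring_1"
  assumes "finite V" "finite S" "fst ` S \<subseteq> V"
  shows "(\<Sum>B\<in>Pow S. \<Prod>v\<in>V. f v (outs B v)) = (\<Prod>v\<in>V. \<Sum>B\<in>Pow (outs S v). f v B)"
proof -
  have "(\<Prod>v\<in>V. \<Sum>B\<in>Pow (outs S v). f v B) = (\<Sum>g\<in>(\<Pi>\<^sub>E v\<in>V. Pow (outs S v)). \<Prod>v\<in>V. f v (g v))"
    using assms by (intro prod_sum_PiE) auto
  also have "\<dots> = (\<Sum>B\<in>Pow S. \<Prod>v\<in>V. f v (outs B v))"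
  proof (rule sum.reindex_bij_witness[where i = "\<lambda>B. \<lambda>v\<in>V. outs B v" and j = "\<lambda>g. \<Union>v\<in>V. g v"])
    fix g assume g: "g \<in> (\<Pi>\<^sub>E v\<in>V. Pow (outs S v))"
    have sub: "g v \<subseteq> outs S v" if "v \<in> V" for v using g that by auto
    have out: "outs (\<Union>v\<in>V. g v) w = g w" if "w \<in> V" for w
      using sub that by (force simp: outs_def)
    show "(\<lambda>v\<in>V. outs (\<Union>v\<in>V. g v) v) = g"
      using g out by (intro ext) (auto simp: PiE_iff extensional_def restrict_def)
    show "(\<Union>v\<in>V. g v) \<in> Pow S" using sub outs_subset by fastforce
    show "(\<Prod>v\<in>V. f v (outs (\<Union>v\<in>V. g v) v)) = (\<Prod>v\<in>V. f v (g v))" using out by simp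
  next
    fix B assume B: "B \<in> Pow S"
    then show "(\<Union>v\<in>V. (\<lambda>v\<in>V. outs B v) v) = B" using assms(3) by (auto simp: outs_def)
    show "(\<lambda>v\<in>V. outs B v) \<in> (\<Pi>\<^sub>E v\<in>V. Pow (outs S v))" using B by (auto simp: outs_def)
  qed
  finally show ?thesis ..
qed

text \<open>Before contraction the half-edges are independent variables, and the sum is a product of
  vertex polynomials in disjoint sets of variables.\<close>

lemma half_edge_poly_nonzero:
  fixes y :: "'a \<times> 'a \<Rightarrow> complex"
  assumes "finite V" "finite S" "fst ` S \<subseteq> V"
    and "\<And>v. v \<in> V \<Longrightarrow> m v \<le> card (outs S v)"
    and "\<And>e. norm (y e) < 1"
  shows "(\<Sum>B\<in>Pow S. (\<Prod>v\<in>V. krawtchouk (card (outs S v)) (m v) (card (outs B v))) * prod y B) \<noteq> 0"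
proof -
  have "(\<Sum>B\<in>Pow S. (\<Prod>v\<in>V. krawtchouk (card (outs S v)) (m v) (card (outs B v))) * prod y B) =
      (\<Sum>B\<in>Pow S. \<Prod>v\<in>V. krawtchouk (card (outs S v)) (m v) (card (outs B v)) * prod y (outs B v))"
  proof (rule sum.cong[OF refl])
    fix B assume "B \<in> Pow S"
    then have "prod y B = (\<Prod>v\<in>V. prod y (outs B v))"
      using assms finite_subset by (intro prod_outs) auto
    then show "(\<Prod>v\<in>V. krawtchouk (card (outs S v)) (m v) (card (outs B v))) * prod y B =
        (\<Prod>v\<in>V. krawtchouk (card (outs S v)) (m v) (card (outs B v)) * prod y (outs B v))"
      by (simp add: prod.distrib)
  qed
  also have "\<dots> = (\<Prod>v\<in>V. \<Sum>B\<in>Pow (outs S v).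
      krawtchouk (card (outs S v)) (m v) (card B) * prod y B)"
    by (rule sum_Pow_prod_outs[OF assms(1-3),
          where f = "\<lambda>v B. krawtchouk (card (outs S v)) (m v) (card B) * prod y B"])
  also have "\<dots> \<noteq> 0"
    unfolding prod_zero_iff[OF assms(1)]
    using vertex_poly_nonzero[OF finite_outs[OF assms(2)] assms(4) assms(5)] by auto
  finally show ?thesis .
qed

theorem symmetric_poly_nonzero:
  fixes y :: "'a \<times> 'a \<Rightarrow> complex"
  assumes "finite V" "finite S" "fst ` S \<subseteq> V" "sym S" "irrefl S"
    and "\<And>v. v \<in> V \<Longrightarrow> m v \<le> card (outs S v)"
    and "\<And>e. norm (y e) < 1"
  shows "(\<Sum>A\<in>symsub S. (\<Prod>v\<in>V. krawtchouk (card (outs S v)) (m v) (card (outs A v))) * prod y A) \<noteq> 0"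
proof -
  let ?c = "\<lambda>A. \<Prod>v\<in>V. krawtchouk (card (outs S v)) (m v) (card (outs A v)) :: complex"
  have "(\<Sum>B\<in>Pow S. if sym (B \<inter> S) then ?c B * prod y B else 0) \<noteq> 0"
    using assms half_edge_poly_nonzero[OF assms(1-3,6)]
    by (intro Asano_contraction_symmetric[where S = S and c = ?c]) auto
  moreover have "(\<Sum>B\<in>Pow S. if sym (B \<inter> S) then ?c B * prod y B else 0) =
      (\<Sum>A\<in>symsub S. ?c A * prod y A)"
    using assms(2) unfolding symsub_def
    by (intro sum.mono_neutral_cong_right) (auto simp: Int_absorb2)
  ultimately show ?thesis by simp
qed

section \<open>The sign of the central Krawtchouk coefficients\<close>

text \<open>Reversing the coefficients of the generating polynomial changes its sign, since (1 - X)
  occurs to an odd power; the middle coefficient is then its own negative.\<close>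

lemma krawtchouk_central_odd:
  assumes "odd k" "k \<le> 2 * m"
  shows "krawtchouk (2 * m) m k = (0::real)"
proof -
  define p :: "real poly" where "p = [:1, -1:] ^ k * [:1, 1:] ^ (2 * m - k)"
  have deg: "degree p = 2 * m"
    unfolding p_def using assms by (subst degree_mult_eq) (auto simp: degree_power_eq)
  have "reflect_poly [:1, -1::real:] = - [:1, -1:]" "reflect_poly [:1, 1::real:] = [:1, 1:]"
    by (simp_all add: reflect_poly_def)
  then have "reflect_poly p = - p"
    unfolding p_def reflect_poly_mult reflect_poly_power
    by (simp only: power_minus_odd[OF assms(1)] mult_minus_left)
  then have "coeff p m = - coeff p m"
    using coeff_reflect_poly[of p m] deg by simp
  then show ?thesis by (simp add: krawtchouk_def p_def)
qed

text \<open>The numbers on the right are the super Catalan numbers of \<open>l\<close> and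
  \<open>m - l\<close>, and they are visibly positive. The induction rests on (1 - X)^2 = (1 + X)^2
  - 4 X, which expresses the case \<open>Suc l\<close> by the case \<open>l\<close> for
  \<open>m\<close> and for \<open>m - 1\<close>.\<close>

lemma krawtchouk_central_even:
  assumes "l \<le> m"
  shows "(-1) ^ l * krawtchouk (2 * m) m (2 * l) =
    (fact (2 * l) * fact (2 * (m - l)) / (fact l * fact (m - l) * fact m) :: real)"
  using assms
proof (induction l arbitrary: m)
  case 0
  show ?case
    by (simp add: krawtchouk_def coeff_linear_poly_power binomial_fact mult_2)
next
  case (Suc l)
  then obtain m' where m: "m = Suc m'" "l \<le> m'" by (cases m) auto
  define P :: "real poly" where "P = [:1, -1:] ^ (2 * l) * [:1, 1:] ^ (2 * m' - 2 * l)"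
  have sq: "[:1, -1::real:] ^ 2 = [:1, 1:] ^ 2 - [:0, 4:]" by (simp add: power2_eq_square)
  have e1: "2 * Suc l = 2 * l + 2" "2 * m - (2 * l + 2) = 2 * m' - 2 * l"
    "2 * m - 2 * l = (2 * m' - 2 * l) + 2" using m by auto
  have "krawtchouk (2 * m) m (2 * Suc l) = coeff (P * [:1, -1:] ^ 2) m"
    unfolding krawtchouk_def P_def e1 power_add by (simp only: mult_ac)
  also have "\<dots> = coeff (P * [:1, 1:] ^ 2) m - coeff (P * [:0, 4:]) m"
    by (simp only: sq right_diff_distrib coeff_diff)
  also have "coeff (P * [:1, 1:] ^ 2) m = krawtchouk (2 * m) m (2 * l)"
    unfolding krawtchouk_def P_def e1 power_add by (simp only: mult_ac)
  also have "P * [:0, 4:] = pCons 0 (smult 4 P)" by simp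
  also have "coeff (pCons 0 (smult 4 P)) m = 4 * krawtchouk (2 * m') m' (2 * l)"
    by (simp add: m P_def krawtchouk_def)
  finally have rec: "krawtchouk (2 * m) m (2 * Suc l) =
      krawtchouk (2 * m) m (2 * l) - 4 * (krawtchouk (2 * m') m' (2 * l) :: real)" .
  define j where "j = m' - l"
  have j: "m' = l + j" "m - l = Suc j" "m' - l = j" "m - Suc l = j" using m by (auto simp: j_def)
  have IH1: "(-1) ^ l * krawtchouk (2 * m) m (2 * l) =
      (fact (2 * l) * fact (2 * Suc j) / (fact l * fact (Suc j) * fact m) :: real)"
    using Suc.IH[of m] m by (simp add: j)
  have IH2: "(-1) ^ l * krawtchouk (2 * m') m' (2 * l) =
      (fact (2 * l) * fact (2 * j) / (fact l * fact j * fact m') :: real)"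
    using Suc.IH[of m'] m(2) by (simp only: j(3))
  have fm: "fact m = (real l + real j + 1) * fact m'" by (simp add: m j)
  have fj: "fact (2 * Suc j) = (2 * real j + 2) * (2 * real j + 1) * fact (2 * j)"
    "fact (Suc j) = (real j + 1) * fact j" by (simp_all add: algebra_simps)
  have fl: "fact (2 * Suc l) = (2 * real l + 2) * (2 * real l + 1) * fact (2 * l)"
    "fact (Suc l) = (real l + 1) * fact l" by (simp_all add: algebra_simps)
  have nz: "real l + 1 \<noteq> 0" "real j + 1 \<noteq> 0" "real l + real j + 1 \<noteq> 0" by linarith+
  have "(-1) ^ Suc l * krawtchouk (2 * m) m (2 * Suc l) =
      4 * ((-1) ^ l * krawtchouk (2 * m') m' (2 * l)) - (-1) ^ l * (krawtchouk (2 * m) m (2 * l) :: real)"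
    unfolding rec power_Suc by (simp add: right_diff_distrib)
  also have "\<dots> = fact (2 * Suc l) * fact (2 * j) / (fact (Suc l) * fact j * fact m)"
    unfolding IH1 IH2 fm fj fl using nz
    by (simp add: divide_simps) (simp add: algebra_simps)
  finally show ?case by (simp only: j)
qed

lemma krawtchouk_of_real:
  assumes "k \<le> n"
  shows "(krawtchouk n m k :: complex) = of_real (krawtchouk n m k)"
proof -
  have "{..<k} \<subseteq> {..<n}" using assms by auto
  note sum = krawtchouk_sum[OF finite_lessThan this, where m = m, unfolded card_lessThan]
  have "(if b then - 1 else 1 :: complex) = of_real (if b then - 1 else 1)" for b by simp
  then show ?thesis
    by (simp only: sum[symmetric] of_real_sum of_real_prod)
qed

text \<open>
  The factor \<open>\<i> ^ k\<close> turns the product over the vertices into the sign \<open>(-1)\<close> per undirected edge of the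
  expansion of \<open>\<Prod> (1 - \<sigma> \<sigma>') / 2\<close>, and it makes the weights of vertices of even degree nonnegative.
\<close>

definition vertex_weight :: "nat \<Rightarrow> nat \<Rightarrow> complex" where
  "vertex_weight d k = \<i> ^ k * krawtchouk d (d div 2) k"

definition abs_weight :: "nat \<Rightarrow> nat \<Rightarrow> real" where
  "abs_weight d k = \<bar>krawtchouk d (d div 2) k\<bar>"

text \<open>For even \<open>k\<close> the power of \<open>\<i>\<close> is exactly the sign in
  \<open>krawtchouk_central_even\<close>; for odd \<open>k\<close> both sides vanish. This is the
  source of the nonnegative coefficients.\<close>

lemma vertex_weight_even:
  assumes "even d" "k \<le> d"
  shows "vertex_weight d k = of_real (abs_weight d k)"
proof -
  obtain m where m: "d = 2 * m" using assms by auto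
  show ?thesis
  proof (cases "even k")
    case True
    then obtain l where l: "k = 2 * l" by auto
    have "l \<le> m" using assms m l by simp
    from krawtchouk_central_even[OF this]
    have nonneg: "(-1) ^ l * krawtchouk d m k \<ge> (0::real)" by (simp only: m l) simp
    have "\<bar>krawtchouk d m k\<bar> = \<bar>(-1) ^ l * krawtchouk d m k :: real\<bar>" by (simp add: abs_mult)
    also have "\<dots> = (-1) ^ l * krawtchouk d m k" using nonneg by simp
    finally have "abs_weight d k = (-1) ^ l * krawtchouk d m k" by (simp add: abs_weight_def m)
    moreover have "\<i> ^ k = (-1) ^ l" by (simp add: l power_mult)
    ultimately show ?thesis using assms(2) by (simp add: vertex_weight_def krawtchouk_of_real m)
  next
    case False
    then have "krawtchouk d m k = (0::real)" using krawtchouk_central_odd[of k m] assms m by simp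
    then show ?thesis using assms(2) by (simp add: vertex_weight_def abs_weight_def krawtchouk_of_real m)
  qed
qed

lemma abs_weight_nonneg: "abs_weight d k \<ge> 0" by (simp add: abs_weight_def)

section \<open>The partition function\<close>

definition deg :: "'a pair_pre_digraph \<Rightarrow> 'a \<Rightarrow> nat" where
  "deg G v = card (outs (parcs G) v)"

lemma deg_eq_out_degree: "out_degree (with_proj G) v = deg G v"
  by (simp add: out_degree_def out_arcs_def deg_def outs_def)

lemma pair_graph_arcs:
  assumes "pair_graph G"
  shows "finite (pverts G)" "finite (parcs G)" "sym (parcs G)" "irrefl (parcs G)"
    "parcs G \<subseteq> pverts G \<times> pverts G" "fst ` parcs G \<subseteq> pverts G"
proof -
  interpret pair_graph G by fact
  show "finite (pverts G)" "finite (parcs G)" using pair_finite_verts pair_finite_arcs by auto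
  show "sym (parcs G)" using arcs_symmetric by (auto intro: symI)
  show "irrefl (parcs G)" using pair_no_loops by (force simp: irrefl_def)
  show "parcs G \<subseteq> pverts G \<times> pverts G" "fst ` parcs G \<subseteq> pverts G"
    using in_arcsD1 in_arcsD2 by auto
qed

definition arcs_weight :: "'a pair_pre_digraph \<Rightarrow> 'a rel \<Rightarrow> complex" where
  "arcs_weight G A = (\<Prod>v\<in>pverts G. vertex_weight (deg G v) (card (outs A v)))"

text \<open>Both arcs of an edge are counted by \<open>card A\<close>, so an edge carries the weight \<open>t\<^sup>2\<close>.\<close>

definition part_fun :: "'a pair_pre_digraph \<Rightarrow> complex \<Rightarrow> complex" where
  "part_fun G t = (\<Sum>A\<in>symsub (parcs G). arcs_weight G A * t ^ card A)"

text \<open>The share of \<open>e\<close> in the derivative of \<open>part_fun G\<close>: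
  differentiating \<open>t ^ card A\<close> yields one term for each arc of \<open>A\<close>.
  Accordingly \<open>t * arc_fun G e t / part_fun G t\<close> is the marginal of
  \<open>e\<close>.\<close>

definition arc_fun :: "'a pair_pre_digraph \<Rightarrow> 'a \<times> 'a \<Rightarrow> complex \<Rightarrow> complex" where
  "arc_fun G e t = (\<Sum>A | A \<in> symsub (parcs G) \<and> e \<in> A. arcs_weight G A * t ^ (card A - 1))"

lemma arcs_weight_times_prod:
  assumes "pair_graph G" "A \<in> symsub (parcs G)"
  shows "(\<Prod>v\<in>pverts G. krawtchouk (deg G v) (deg G v div 2) (card (outs A v))) *
      (\<Prod>e\<in>A. \<i> * y e) = arcs_weight G A * prod y A"
proof -
  note G = pair_graph_arcs[OF assms(1)]
  have A: "finite A" "fst ` A \<subseteq> pverts G"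
    using assms(2) G finite_subset by (auto simp: symsub_def)
  have "(\<Prod>e\<in>A. \<i>) = (\<Prod>v\<in>pverts G. \<i> ^ card (outs A v))"
    using prod_outs[OF G(1) A, of "\<lambda>_. \<i>"] by simp
  then show ?thesis
    by (simp only: prod.distrib arcs_weight_def vertex_weight_def mult_ac)
qed

text \<open>The factor \<open>\<i>\<close> at each half-edge rotates the variables within the unit
  disc. Since \<open>deg G v div 2\<close> is an admissible degree at odd vertices too, balls are
  covered.\<close>

lemma symmetric_weighted_sum_nonzero:
  assumes "pair_graph G" "\<And>e. norm (y e) < 1"
  shows "(\<Sum>A\<in>symsub (parcs G). arcs_weight G A * prod y A) \<noteq> 0"
proof -
  note G = pair_graph_arcs[OF assms(1)]
  have "(\<Sum>A\<in>symsub (parcs G). (\<Prod>v\<in>pverts G.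
      krawtchouk (card (outs (parcs G) v)) (deg G v div 2) (card (outs A v))) * (\<Prod>e\<in>A. \<i> * y e)) \<noteq> 0"
    using assms by (intro symmetric_poly_nonzero G) (auto simp: deg_def norm_mult)
  then show ?thesis
    using arcs_weight_times_prod[OF assms(1)] by (simp flip: deg_def)
qed

lemma part_fun_nonzero:
  assumes "pair_graph G" "norm t < 1"
  shows "part_fun G t \<noteq> 0"
  using symmetric_weighted_sum_nonzero[OF assms(1), of "\<lambda>_. t"] assms(2)
  by (simp add: part_fun_def)

lemma arc_fun_times:
  assumes "finite (parcs G)"
  shows "t * arc_fun G e t = (\<Sum>A | A \<in> symsub (parcs G) \<and> e \<in> A. arcs_weight G A * t ^ card A)"
  unfolding arc_fun_def sum_distrib_left
proof (rule sum.cong[OF refl])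
  fix A assume "A \<in> {A \<in> symsub (parcs G). e \<in> A}"
  then have "card A \<noteq> 0" using assms by (auto simp: symsub_def card_eq_0_iff dest: finite_subset)
  then have "t ^ card A = t * t ^ (card A - 1)" by (cases "card A") auto
  then show "t * (arcs_weight G A * t ^ (card A - 1)) = arcs_weight G A * t ^ card A"
    by simp
qed

text \<open>
  Giving the edge of \<open>e\<close> the weight \<open>s * t\<^sup>2\<close> instead of \<open>t\<^sup>2\<close> changes the partition function \<open>W + N\<close> into
  \<open>W + s * N\<close>, which still has no zero for \<open>norm (s * t\<^sup>2) < 1\<close>.
\<close>

lemma arc_fun_bound:
  assumes G: "pair_graph G" and t: "norm t < 1"
  shows "norm (t * arc_fun G e t / part_fun G t) \<le> (norm t)\<^sup>2 / (1 - (norm t)\<^sup>2)"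
proof (cases "t = 0 \<or> e \<notin> parcs G")
  case True
  then have "t * arc_fun G e t = 0" by (auto simp: arc_fun_def symsub_def intro!: sum.neutral)
  moreover have "(norm t)\<^sup>2 < 1" using t by (simp add: abs_square_less_1)
  ultimately show ?thesis by auto
next
  case False
  note G' = pair_graph_arcs[OF G]
  obtain a b where e: "e = (a, b)" by force
  have ab: "a \<noteq> b" using False G'(4) by (auto simp: e irrefl_def)
  define N where "N = t * arc_fun G e t"
  define W where "W = (\<Sum>A | A \<in> symsub (parcs G) \<and> e \<notin> A. arcs_weight G A * t ^ card A)"
  have sum_split: "(\<Sum>A\<in>symsub (parcs G). g A) = (\<Sum>A | A \<in> symsub (parcs G) \<and> e \<notin> A. g A) +
      (\<Sum>A | A \<in> symsub (parcs G) \<and> e \<in> A. g A)" for g :: "'a rel \<Rightarrow> complex"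
    using G' by (subst sum.union_disjoint[symmetric]) (auto intro: sum.cong)
  have F: "part_fun G t = W + N"
    unfolding part_fun_def sum_split W_def N_def arc_fun_times[OF G'(2)] ..
  have nz: "W + s * N \<noteq> 0" if s: "norm s * (norm t)\<^sup>2 < 1" for s
  proof -
    \<comment> \<open>Each of the two arcs of the edge receives a square root of \<open>s\<close>,
      so a subset containing the edge gains exactly the factor \<open>s\<close>.\<close>
    define y where "y p = (if p = (a, b) \<or> p = (b, a) then csqrt s * t else t)" for p
    have "(norm (csqrt s * t))\<^sup>2 < 1"
      using s by (simp add: norm_mult power_mult_distrib flip: norm_power)
    then have y: "norm (y p) < 1" for p
      using t by (auto simp: y_def abs_square_less_1)
    have 1: "prod y A = t ^ card A" if "A \<in> symsub (parcs G)" "e \<notin> A" for A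
    proof -
      have "(a, b) \<notin> A" "(b, a) \<notin> A" using that by (auto simp: e symsub_def dest: symD)
      then have "prod y A = (\<Prod>p\<in>A. t)" by (intro prod.cong) (auto simp: y_def)
      then show ?thesis by simp
    qed
    have 2: "prod y A = s * t ^ card A" if "A \<in> symsub (parcs G)" "e \<in> A" for A
    proof -
      define B where "B = A - {(a, b), (b, a)}"
      have A: "A = insert (a, b) (insert (b, a) B)" using that by (auto simp: e symsub_def B_def dest: symD)
      have B: "finite B" "(a, b) \<notin> B" "(b, a) \<notin> B"
        using that G'(2) finite_subset by (auto simp: symsub_def B_def)
      have "prod y B = (\<Prod>p\<in>B. t)" by (intro prod.cong) (auto simp: y_def B_def)
      then have "prod y A = (csqrt s * t) * (csqrt s * t) * t ^ card B"
        unfolding A using B ab by (subst prod_insert2) (auto simp: y_def)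
      also have "\<dots> = (csqrt s)\<^sup>2 * t ^ card A"
        unfolding A using B ab by (simp add: power2_eq_square)
      finally show ?thesis by simp
    qed
    have "(\<Sum>A\<in>symsub (parcs G). arcs_weight G A * prod y A) = W + s * N"
      unfolding sum_split W_def N_def arc_fun_times[OF G'(2)] sum_distrib_left
      by (intro arg_cong2[where f = "(+)"] sum.cong refl) (auto simp: 1 2)
    then show ?thesis using symmetric_weighted_sum_nonzero[of G y] G y by simp
  qed
  define x where "x = (norm t)\<^sup>2"
  have x: "0 < x" "x < 1" using t False by (auto simp: abs_square_less_1 x_def)
  have le: "norm N \<le> x * norm W"
  proof (cases "N = 0")
    case True then show ?thesis using x by simp
  next
    case N: False
    \<comment> \<open>The value \<open>s = - W / N\<close> is a zero of \<open>W + s * N\<close> and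
      must therefore lie outside the zero-free region.\<close>
    have "\<not> norm (- W / N) * x < 1" using nz[of "- W / N"] N by (auto simp: x_def)
    then show ?thesis using N by (simp add: norm_divide field_simps)
  qed
  have "norm W - norm N \<le> norm (W + N)" by (metis norm_diff_ineq)
  then have "x * norm W - x * norm N \<le> x * norm (W + N)"
    using x by (simp flip: right_diff_distrib)
  then have "norm N * (1 - x) \<le> x * norm (W + N)"
    using le by (simp add: algebra_simps)
  moreover have "norm (W + N) > 0" using nz[of 1] x by (simp add: x_def)
  ultimately show ?thesis
    using x unfolding F N_def[symmetric] x_def[symmetric]
    by (simp add: norm_divide field_simps)
qed

section \<open>Eulerian orientations as a value of the partition function\<close>

text \<open>The sum factors over the edges into terms 1 - \<sigma> \<sigma>', the minus sign being
  the product of the two factors \<open>\<i>\<close>. Such a term is 2 for opposite signs and 0 for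
  equal ones.\<close>

lemma sum_symsub_signs:
  fixes X :: "'a rel"
  assumes "finite S" "sym S" "irrefl S"
  shows "(\<Sum>A\<in>symsub S. \<Prod>e\<in>A. \<i> * (if e \<in> X then - 1 else 1)) =
    (if \<forall>(u, v)\<in>S. (u, v) \<in> X \<longleftrightarrow> (v, u) \<notin> X then 2 ^ (card S div 2) else 0)"
  using assms
proof (induction S rule: sym_irrefl_induct)
  case empty
  have "symsub {} = {{} :: 'a rel}" by (auto simp: symsub_def sym_def)
  then show ?case by simp
next
  case (insert S a b)
  have card: "card (insert (a, b) (insert (b, a) S)) div 2 = Suc (card S div 2)"
    using insert.hyps by simp
  have all: "(\<forall>(u, v)\<in>insert (a, b) (insert (b, a) S). (u, v) \<in> X \<longleftrightarrow> (v, u) \<notin> X) \<longleftrightarrow>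
      ((a, b) \<in> X \<longleftrightarrow> (b, a) \<notin> X) \<and> (\<forall>(u, v)\<in>S. (u, v) \<in> X \<longleftrightarrow> (v, u) \<notin> X)"
    by blast
  have factor: "1 + \<i> * (if p then - 1 else 1) * (\<i> * (if q then - 1 else 1)) =
      (if p \<longleftrightarrow> \<not> q then 2 else 0)" for p q
    by simp
  show ?case
    unfolding sum_symsub_prod_insert[OF insert.hyps(1,2,4-6)] insert.IH card all factor
    by simp
qed

lemma part_fun_1:
  assumes G: "pair_graph G" and even: "\<And>v. v \<in> pverts G \<Longrightarrow> even (deg G v)"
  shows "part_fun G 1 = of_nat (num_eulerian_orientations G) * 2 ^ (card (parcs G) div 2)"
proof -
  let ?S = "parcs G" and ?V = "pverts G"
  let ?\<sigma> = "\<lambda>X e. if e \<in> X then - 1 else 1 :: complex"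
  note G' = pair_graph_arcs[OF G]
  \<comment> \<open>A member \<open>X\<close> marks the half-edges of sign -1, exactly half of those
    at each vertex.\<close>
  define \<X> where "\<X> = {X. X \<subseteq> ?S \<and> (\<forall>v\<in>?V. card (outs X v) = deg G v div 2)}"
  have fin: "finite \<X>" using G'(2) by (auto simp: \<X>_def)
  define R where "R X \<longleftrightarrow> (\<forall>(u, v)\<in>?S. (u, v) \<in> X \<longleftrightarrow> (v, u) \<notin> X)" for X
  \<comment> \<open>Each vertex factor is a sum over balanced markings of its own half-edges, and
    the product of these sums is a sum over global markings.\<close>
  have kr: "(\<Prod>v\<in>?V. krawtchouk (deg G v) (deg G v div 2) (card (outs A v))) =
      (\<Sum>X\<in>\<X>. \<Prod>e\<in>A. ?\<sigma> X e)" if A: "A \<in> symsub ?S" for A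
  proof -
    define f where "f v B = (if card B = deg G v div 2 then (\<Prod>e\<in>outs A v. ?\<sigma> B e) else 0)" for v B
    have A': "finite A" "A \<subseteq> ?S" "fst ` A \<subseteq> ?V"
      using A G' finite_subset by (auto simp: symsub_def)
    have "(\<Prod>v\<in>?V. krawtchouk (deg G v) (deg G v div 2) (card (outs A v))) =
        (\<Prod>v\<in>?V. \<Sum>B\<in>Pow (outs ?S v). f v B)"
    proof (rule prod.cong[OF refl])
      fix v
      show "krawtchouk (deg G v) (deg G v div 2) (card (outs A v)) = (\<Sum>B\<in>Pow (outs ?S v). f v B)"
        unfolding deg_def using G'(2) A'(2)
        by (subst krawtchouk_sum[symmetric])
          (auto simp: f_def deg_def outs_mono split: if_splits intro!: sum.mono_neutral_cong_left)
    qed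
    also have "\<dots> = (\<Sum>B\<in>Pow ?S. \<Prod>v\<in>?V. f v (outs B v))"
      by (rule sum_Pow_prod_outs[symmetric]) (use G' in auto)
    also have "\<dots> = (\<Sum>X\<in>\<X>. \<Prod>e\<in>A. ?\<sigma> X e)"
    proof (rule sum.mono_neutral_cong_right)
      show "\<forall>X\<in>Pow ?S - \<X>. (\<Prod>v\<in>?V. f v (outs X v)) = 0"
        using G'(1) by (auto simp: \<X>_def f_def)
      fix X assume "X \<in> \<X>"
      then have "(\<Prod>v\<in>?V. f v (outs X v)) = (\<Prod>v\<in>?V. \<Prod>e\<in>outs A v. ?\<sigma> (outs X v) e)"
        by (intro prod.cong) (auto simp: \<X>_def f_def)
      also have "\<dots> = (\<Prod>v\<in>?V. \<Prod>e\<in>outs A v. ?\<sigma> X e)"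
        by (intro prod.cong) (auto simp: outs_def)
      also have "\<dots> = (\<Prod>e\<in>A. ?\<sigma> X e)"
        by (rule prod_outs[symmetric]) (use A' G' in auto)
      finally show "(\<Prod>v\<in>?V. f v (outs X v)) = (\<Prod>e\<in>A. ?\<sigma> X e)" .
    qed (use G' in \<open>auto simp: \<X>_def\<close>)
    finally show ?thesis .
  qed
  have "part_fun G 1 = (\<Sum>A\<in>symsub ?S. \<Sum>X\<in>\<X>. \<Prod>e\<in>A. \<i> * ?\<sigma> X e)"
    unfolding part_fun_def
  proof (rule sum.cong[OF refl])
    fix A assume A: "A \<in> symsub ?S"
    have "arcs_weight G A * 1 ^ card A = (\<Sum>X\<in>\<X>. \<Prod>e\<in>A. ?\<sigma> X e) * (\<Prod>e\<in>A. \<i>)"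
      using arcs_weight_times_prod[OF G A, of "\<lambda>_. 1"] kr[OF A] by simp
    also have "\<dots> = (\<Sum>X\<in>\<X>. \<Prod>e\<in>A. \<i> * ?\<sigma> X e)"
      unfolding sum_distrib_right prod.distrib by (simp only: mult.commute)
    finally show "arcs_weight G A * 1 ^ card A = (\<Sum>X\<in>\<X>. \<Prod>e\<in>A. \<i> * ?\<sigma> X e)" .
  qed
  also have "\<dots> = (\<Sum>X\<in>\<X>. \<Sum>A\<in>symsub ?S. \<Prod>e\<in>A. \<i> * ?\<sigma> X e)" by (rule sum.swap)
  also have "\<dots> = (\<Sum>X\<in>\<X>. if R X then 2 ^ (card ?S div 2) else 0)"
    unfolding sum_symsub_signs[OF G'(2-4)] R_def ..
  also have "\<dots> = of_nat (card {X \<in> \<X>. R X}) * 2 ^ (card ?S div 2)"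
    using fin by (simp add: sum.inter_filter[symmetric])
  also have "card {X \<in> \<X>. R X} = num_eulerian_orientations G"
  proof -
    \<comment> \<open>The arcs of \<open>D\<close> entering \<open>v\<close> are the reversals of
      the arcs of \<open>G\<close> that leave \<open>v\<close> and are not in
      \<open>D\<close>.\<close>
    have balance: "in_degree (with_proj D) v = deg G v - card (outs (parcs D) v)"
      "card (outs (parcs D) v) \<le> deg G v"
      if D: "orientation G D" for D v
    proof -
      have *: "parcs D \<subseteq> ?S" "\<And>u v. (u, v) \<in> ?S \<Longrightarrow> (u, v) \<in> parcs D \<longleftrightarrow> (v, u) \<notin> parcs D"
        using D by (auto simp: orientation_def)
      have fin: "finite (parcs D)" using *(1) G'(2) by (rule finite_subset)
      have "in_arcs (with_proj D) v = prod.swap ` (outs ?S v - outs (parcs D) v)"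
      proof (intro equalityI subsetI)
        fix e assume "e \<in> in_arcs (with_proj D) v"
        then obtain u where e: "e = (u, v)" "(u, v) \<in> parcs D" by (cases e) (auto simp: in_arcs_def)
        then have "(v, u) \<in> ?S" "(v, u) \<notin> parcs D" using * symD[OF G'(3)] by blast+
        then have "(v, u) \<in> outs ?S v - outs (parcs D) v" by (simp add: outs_def)
        then show "e \<in> prod.swap ` (outs ?S v - outs (parcs D) v)" unfolding e(1) by force
      next
        fix e assume "e \<in> prod.swap ` (outs ?S v - outs (parcs D) v)"
        then obtain f where f: "e = prod.swap f" "f \<in> outs ?S v - outs (parcs D) v" by blast
        then obtain u where "f = (v, u)" by (cases f) (auto simp: outs_def)
        then have e: "e = (u, v)" "(v, u) \<in> ?S" "(v, u) \<notin> parcs D"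
          using f by (simp_all add: outs_def)
        then have "(u, v) \<in> parcs D" using *(2)[OF e(2)] by blast
        then show "e \<in> in_arcs (with_proj D) v" using e(1) by (simp add: in_arcs_def)
      qed
      then have "in_degree (with_proj D) v = card (outs ?S v - outs (parcs D) v)"
        by (simp add: in_degree_def card_image)
      also have "\<dots> = deg G v - card (outs (parcs D) v)"
        unfolding deg_def using fin *(1) by (intro card_Diff_subset outs_mono) auto
      finally show "in_degree (with_proj D) v = deg G v - card (outs (parcs D) v)" .
      show "card (outs (parcs D) v) \<le> deg G v"
        unfolding deg_def using G'(2) *(1) by (intro card_mono finite_outs outs_mono)
    qed
    have iff: "eulerian_orientation G D \<longleftrightarrow> pverts D = ?V \<and> parcs D \<in> \<X> \<and> R (parcs D)" for D
    proof -
      have "orientation G D \<longleftrightarrow> pverts D = ?V \<and> parcs D \<subseteq> ?S \<and> R (parcs D)"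
        by (simp only: orientation_def R_def)
      moreover have "in_degree (with_proj D) v = out_degree (with_proj D) v \<longleftrightarrow>
          card (outs (parcs D) v) = deg G v div 2" if "orientation G D" "v \<in> ?V" for v
        using balance[OF that(1), of v] even[OF that(2)] unfolding deg_eq_out_degree
        by (auto simp: deg_def)
      ultimately show ?thesis by (auto simp: eulerian_orientation_def \<X>_def)
    qed
    have "bij_betw parcs {D. eulerian_orientation G D} {X \<in> \<X>. R X}"
      by (rule bij_betwI[where g = "\<lambda>X. \<lparr>pverts = ?V, parcs = X\<rparr>"]) (auto simp: iff)
    then show ?thesis unfolding num_eulerian_orientations_def by (simp add: bij_betw_same_card)
  qed
  finally show ?thesis .
qed

section \<open>Locality\<close>

lemma ball_verts_eq:
  assumes "pair_graph G" "v \<in> pverts G"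
  shows "ball_verts G r v = {u. \<exists>k\<le>r. (v, u) \<in> parcs G ^^ k}"
proof -
  interpret pair_graph G by fact
  have 1: "(v, u) \<in> parcs G ^^ length p" if "awalk v p u" for v p u
    using that
  proof (induction p arbitrary: v)
    case (Cons e p)
    then have "(v, snd e) \<in> parcs G" "(snd e, u) \<in> parcs G ^^ length p"
      by (cases e; auto simp: awalk_Cons_iff)+
    then show ?case using relpow_Suc_I2 by fastforce
  qed (simp add: awalk_Nil_iff)
  have 2: "\<exists>p. awalk v p u \<and> length p = k" if "(v, u) \<in> parcs G ^^ k" "v \<in> pverts G" for v u k
    using that
  proof (induction k arbitrary: v)
    case 0
    then show ?case by (auto simp: awalk_Nil_iff)
  next
    case (Suc k)
    then obtain w where w: "(v, w) \<in> parcs G" "(w, u) \<in> parcs G ^^ k"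
      by (metis relpow_Suc_D2)
    then obtain p where "awalk w p u" "length p = k" using Suc.IH in_arcsD2 by blast
    then have "awalk v ((v, w) # p) u" using w by (auto simp: awalk_Cons_iff)
    then show ?case using \<open>length p = k\<close> by (metis length_Cons)
  qed
  show ?thesis using 1 2[OF _ assms(2)] unfolding ball_verts_def by blast
qed

lemma relpow_subset: "A \<subseteq> B \<Longrightarrow> A ^^ k \<subseteq> B ^^ k" for A B :: "'a rel"
  by (induction k) (simp_all add: relcomp_mono)

text \<open>Membership depends on the tail alone and is not restricted to \<open>A\<close>, so
  intersecting any arc set with it keeps or discards the star of each vertex as a whole.\<close>

definition arc_component :: "'a \<Rightarrow> 'a rel \<Rightarrow> 'a rel" where
  "arc_component v A = {e. (v, fst e) \<in> A\<^sup>*}"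

text \<open>The exchange leaves \<open>A \<union> B\<close> unchanged, hence also the component
  \<open>K\<close>; therefore a second exchange undoes the first.\<close>

definition swap_component :: "'a \<Rightarrow> 'a rel \<times> 'a rel \<Rightarrow> 'a rel \<times> 'a rel" where
  "swap_component v = (\<lambda>(A, B). let K = arc_component v (A \<union> B) in
     (A - K \<union> B \<inter> K, B - K \<union> A \<inter> K))"

lemma arc_fun_0:
  assumes "pair_graph G"
  shows "arc_fun G e 0 = 0"
  unfolding arc_fun_def
proof (intro sum.neutral ballI)
  note G = pair_graph_arcs[OF assms]
  fix A assume "A \<in> {A \<in> symsub (parcs G). e \<in> A}"
  then have A: "A \<subseteq> parcs G" "sym A" "e \<in> A" by (auto simp: symsub_def)
  then have "{e, prod.swap e} \<subseteq> A" by (cases e) (auto dest: symD)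
  moreover have "e \<noteq> prod.swap e" using A G(4) by (cases e) (auto simp: irrefl_def)
  moreover have "finite A" using A(1) G(2) finite_subset by blast
  ultimately have "2 \<le> card A" by (metis card_2_iff card_mono)
  then show "arcs_weight G A * 0 ^ (card A - 1) = 0" by simp
qed

text \<open>In the application \<open>W\<close> is the vertex set of the ball of radius
  \<open>n\<close> around \<open>v\<close> in \<open>G\<close>, and \<open>H\<close> is the ball of
  radius \<open>n + 1\<close>: the additional layer preserves the degrees of all vertices in
  \<open>W\<close>.\<close>

locale local_agreement =
  fixes G H :: "'a pair_pre_digraph" and v :: 'a and n :: nat and W :: "'a set"
  assumes G: "pair_graph G" and H: "pair_graph H"
    and arcs_subset: "parcs H \<subseteq> parcs G"
    and reach: "\<And>x k. k \<le> n \<Longrightarrow> (v, x) \<in> parcs G ^^ k \<Longrightarrow> x \<in> W"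
    and W_subset: "W \<subseteq> pverts G" "W \<subseteq> pverts H"
    and deg_eq: "\<And>x. x \<in> W \<Longrightarrow> deg H x = deg G x"
    and arcs_W: "\<And>x y. (x, y) \<in> parcs G \<Longrightarrow> x \<in> W \<Longrightarrow> y \<in> W \<Longrightarrow> (x, y) \<in> parcs H"
begin

definition close_pairs :: "('a rel \<times> 'a rel) set" where
  "close_pairs = {(A, B). A \<in> symsub (parcs G) \<and> B \<in> symsub (parcs H) \<and> card (A \<union> B) \<le> n}"

definition pair_weight :: "complex \<Rightarrow> 'a rel \<times> 'a rel \<Rightarrow> complex" where
  "pair_weight t = (\<lambda>(A, B). arcs_weight G A * arcs_weight H B * t ^ (card A + card B))"

text \<open>
  If \<open>A \<union> B\<close> has at most \<open>n\<close> arcs, then the component of \<open>v\<close> stays in the region \<open>W\<close> where both graphs agree.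
\<close>

lemma swap_close_pairs:
  assumes "P \<in> close_pairs"
  shows "swap_component v P \<in> close_pairs" "swap_component v (swap_component v P) = P"
    "pair_weight t (swap_component v P) = pair_weight t P"
    "fst e = v \<Longrightarrow> e \<in> fst (swap_component v P) \<longleftrightarrow> e \<in> snd P"
    "fst e = v \<Longrightarrow> e \<in> snd (swap_component v P) \<longleftrightarrow> e \<in> fst P"
proof -
  note G' = pair_graph_arcs[OF G] and H' = pair_graph_arcs[OF H]
  obtain A B where P: "P = (A, B)" by force
  have AB: "A \<subseteq> parcs G" "sym A" "B \<subseteq> parcs H" "sym B" "card (A \<union> B) \<le> n"
    using assms by (auto simp: close_pairs_def P symsub_def)
  have fin: "finite A" "finite B" using AB G' H' finite_subset by blast+
  define R where "R = {x. (v, x) \<in> (A \<union> B)\<^sup>*}"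
  define K where "K = arc_component v (A \<union> B)"
  have K: "e \<in> K \<longleftrightarrow> fst e \<in> R" for e by (simp add: K_def R_def arc_component_def)
  have vR: "v \<in> R" by (simp add: R_def)
  have closed: "y \<in> R" if "(x, y) \<in> A \<union> B" "x \<in> R" for x y
    using that unfolding R_def by (auto intro: rtrancl_into_rtrancl)
  have sym: "(y, x) \<in> A \<union> B" if "(x, y) \<in> A \<union> B" for x y
    using that AB by (auto dest: symD)
  \<comment> \<open>A reachable vertex is reached by a walk no longer than the number of arcs, hence
    of length at most \<open>n\<close>.\<close>
  have RW: "R \<subseteq> W"
  proof
    fix x assume "x \<in> R"
    moreover have "finite (A \<union> B)" using fin by simp
    ultimately obtain k where "k \<le> card (A \<union> B)" "(v, x) \<in> (A \<union> B) ^^ k"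
      unfolding R_def rtrancl_finite_eq_relpow[OF \<open>finite (A \<union> B)\<close>] by auto
    moreover have "(A \<union> B) ^^ k \<subseteq> parcs G ^^ k" using AB arcs_subset by (intro relpow_subset) auto
    ultimately show "x \<in> W" using reach[of k x] AB(5) by auto
  qed
  define A' where "A' = A - K \<union> B \<inter> K"
  define B' where "B' = B - K \<union> A \<inter> K"
  have swap: "swap_component v P = (A', B')"
    by (simp add: P swap_component_def A'_def B'_def K_def Let_def)
  have union: "A' \<union> B' = A \<union> B" by (auto simp: A'_def B'_def)
  have symK: "sym (C \<inter> K)" "sym (C - K)" if "sym C" "C \<subseteq> A \<union> B" for C
    using that closed sym by (auto simp: K sym_def) blast+
  have "sym A'" "sym B'" unfolding A'_def B'_def using symK AB by (auto intro!: sym_Un)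
  moreover have "A' \<subseteq> parcs G" using AB arcs_subset by (auto simp: A'_def)
  moreover have "B' \<subseteq> parcs H"
  proof -
    have "(x, y) \<in> parcs H" if "(x, y) \<in> A" "x \<in> R" for x y
      using that closed[of x y] RW AB by (intro arcs_W) auto
    then show ?thesis using AB by (auto simp: B'_def K)
  qed
  ultimately show "swap_component v P \<in> close_pairs"
    unfolding swap close_pairs_def symsub_def using AB(5) union by simp
  have eq: "swap_component v (A', B') = (A' - K \<union> B' \<inter> K, B' - K \<union> A' \<inter> K)"
    by (simp add: swap_component_def union K_def Let_def)
  show "swap_component v (swap_component v P) = P"
    unfolding swap unfolding eq P by (auto simp: A'_def B'_def)
  show "e \<in> fst (swap_component v P) \<longleftrightarrow> e \<in> snd P" "e \<in> snd (swap_component v P) \<longleftrightarrow> e \<in> fst P"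
    if "fst e = v" for e
    using that vR unfolding swap unfolding P by (auto simp: A'_def B'_def K)
  show "pair_weight t (swap_component v P) = pair_weight t P"
  proof -
    have card: "card A = card (A - K) + card (A \<inter> K)" "card B = card (B - K) + card (B \<inter> K)"
      using fin by (metis add.commute card_Int_Diff)+
    have "card A' = card (A - K) + card (B \<inter> K)" "card B' = card (B - K) + card (A \<inter> K)"
      unfolding A'_def B'_def using fin by (auto intro!: card_Un_disjoint)
    then have cards: "card A' + card B' = card A + card B" using card by simp
    have outs: "outs A' x = (if x \<in> R then outs B x else outs A x)"
      "outs B' x = (if x \<in> R then outs A x else outs B x)" for x
      by (auto simp: outs_def A'_def B'_def K)
    have R: "R \<subseteq> pverts G" "R \<subseteq> pverts H" using RW W_subset by auto
    \<comment> \<open>Inside \<open>R\<close> the degrees in \<open>G\<close> and \<open>H\<close>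
      coincide, so the factor over \<open>R\<close> is the same function of \<open>C\<close> for
      both graphs and the exchange merely permutes the factors.\<close>
    have split: "arcs_weight G C = (\<Prod>x\<in>R. vertex_weight (deg G x) (card (outs C x))) *
        (\<Prod>x\<in>pverts G - R. vertex_weight (deg G x) (card (outs C x)))"
      "arcs_weight H C = (\<Prod>x\<in>R. vertex_weight (deg G x) (card (outs C x))) *
        (\<Prod>x\<in>pverts H - R. vertex_weight (deg H x) (card (outs C x)))" for C
    proof -
      show "arcs_weight G C = (\<Prod>x\<in>R. vertex_weight (deg G x) (card (outs C x))) *
          (\<Prod>x\<in>pverts G - R. vertex_weight (deg G x) (card (outs C x)))"
        unfolding arcs_weight_def using R G' by (simp add: prod.subset_diff mult.commute)
      have "(\<Prod>x\<in>R. vertex_weight (deg G x) (card (outs C x))) =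
          (\<Prod>x\<in>R. vertex_weight (deg H x) (card (outs C x)))"
        using RW deg_eq by (intro prod.cong) auto
      then show "arcs_weight H C = (\<Prod>x\<in>R. vertex_weight (deg G x) (card (outs C x))) *
          (\<Prod>x\<in>pverts H - R. vertex_weight (deg H x) (card (outs C x)))"
        unfolding arcs_weight_def using R H' by (simp add: prod.subset_diff mult.commute)
    qed
    have "arcs_weight G A' * arcs_weight H B' = arcs_weight G A * arcs_weight H B"
      unfolding split by (simp add: outs)
    then show ?thesis unfolding swap unfolding P by (simp add: pair_weight_def cards)
  qed
qed

text \<open>The involution \<open>swap_component v\<close> preserves the weight and interchanges the
  two indicators, so the sum equals its own negative.\<close>

lemma close_pairs_cancel:
  assumes "fst e = v"
  shows "(\<Sum>P\<in>close_pairs. (of_bool (e \<in> fst P) - of_bool (e \<in> snd P)) * pair_weight t P) = 0"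
proof -
  let ?f = "\<lambda>P. (of_bool (e \<in> fst P) - of_bool (e \<in> snd P)) * pair_weight t P"
  have "(\<Sum>P\<in>close_pairs. ?f P) = (\<Sum>P\<in>close_pairs. - ?f P)"
    by (rule sum.reindex_bij_witness[where i = "swap_component v" and j = "swap_component v"])
      (simp_all add: swap_close_pairs assms algebra_simps)
  then show ?thesis by (simp add: sum_negf)
qed

text \<open>Over the common denominator the numerator is a sum over pairs of edge subsets. The close
  pairs cancel, and for every other pair \<open>card A + card B\<close> is at least
  \<open>Suc n\<close>. Zero-freeness makes the remaining quotient holomorphic.\<close>

lemma arc_fun_agreement:
  assumes "fst e = v"
  obtains g where "g holomorphic_on ball 0 1"
    "\<And>t. norm t < 1 \<Longrightarrow>
      t * arc_fun G e t / part_fun G t - t * arc_fun H e t / part_fun H t = t ^ Suc n * g t"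
proof -
  note G' = pair_graph_arcs[OF G] and H' = pair_graph_arcs[OF H]
  let ?SG = "symsub (parcs G)" and ?SH = "symsub (parcs H)"
  let ?c = "\<lambda>P. of_bool (e \<in> fst P) - of_bool (e \<in> snd P) :: complex"
  define far where "far = ?SG \<times> ?SH - close_pairs"
  define p where "p t = (\<Sum>(A, B)\<in>far. ?c (A, B) * arcs_weight G A * arcs_weight H B *
      t ^ (card A + card B - Suc n))" for t
  have fin: "finite (?SG \<times> ?SH)" using G' H' by simp
  have num: "t * arc_fun G e t * part_fun H t - t * arc_fun H e t * part_fun G t = t ^ Suc n * p t" for t
  proof -
    have a: "t * arc_fun X e t = (\<Sum>A\<in>symsub (parcs X). of_bool (e \<in> A) * (arcs_weight X A * t ^ card A))"
      if "finite (parcs X)" for X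
      unfolding arc_fun_times[OF that] using that by (intro sum.mono_neutral_cong_left) auto
    have "t * arc_fun G e t * part_fun H t - t * arc_fun H e t * part_fun G t =
        (\<Sum>P\<in>?SG \<times> ?SH. ?c P * pair_weight t P)"
    proof -
      have "t * arc_fun G e t * part_fun H t =
          (\<Sum>(A, B)\<in>?SG \<times> ?SH. of_bool (e \<in> A) * pair_weight t (A, B))"
        unfolding a[OF G'(2)] part_fun_def sum_product sum.cartesian_product
        by (simp add: pair_weight_def power_add mult_ac)
      moreover have "part_fun G t * (t * arc_fun H e t) =
          (\<Sum>(A, B)\<in>?SG \<times> ?SH. of_bool (e \<in> B) * pair_weight t (A, B))"
        unfolding a[OF H'(2)] part_fun_def sum_product sum.cartesian_product
        by (simp add: pair_weight_def power_add mult_ac)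
      ultimately show ?thesis
        by (simp add: mult.commute[of "part_fun G t"] left_diff_distrib sum_subtractf case_prod_unfold)
    qed
    also have "\<dots> = (\<Sum>P\<in>far. ?c P * pair_weight t P)"
    proof -
      have sub: "close_pairs \<subseteq> ?SG \<times> ?SH" by (auto simp: close_pairs_def)
      show ?thesis
        unfolding sum.subset_diff[OF sub fin] far_def close_pairs_cancel[OF assms] by simp
    qed
    also have "\<dots> = t ^ Suc n * p t"
      unfolding p_def sum_distrib_left
    proof (rule sum.cong[OF refl])
      fix P assume P: "P \<in> far"
      obtain A B where AB: "P = (A, B)" by force
      have "n < card (A \<union> B)" using P by (auto simp: AB far_def close_pairs_def)
      also have "\<dots> \<le> card A + card B" by (rule card_Un_le)
      finally have "card A + card B = Suc n + (card A + card B - Suc n)" by simp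
      then have "t ^ (card A + card B) = t ^ Suc n * t ^ (card A + card B - Suc n)"
        by (metis power_add)
      then show "?c P * pair_weight t P = t ^ Suc n * (case P of (A, B) \<Rightarrow>
          ?c (A, B) * arcs_weight G A * arcs_weight H B * t ^ (card A + card B - Suc n))"
        unfolding AB pair_weight_def prod.case by (simp only: mult_ac)
    qed
    finally show ?thesis .
  qed
  define g where "g t = p t / (part_fun G t * part_fun H t)" for t
  show thesis
  proof
    show "g holomorphic_on ball 0 1"
      unfolding g_def p_def case_prod_unfold part_fun_def
      using part_fun_nonzero[OF G, unfolded part_fun_def] part_fun_nonzero[OF H, unfolded part_fun_def]
      by (intro holomorphic_intros) auto
    fix t :: complex assume t: "norm t < 1"
    have nz: "part_fun G t \<noteq> 0" "part_fun H t \<noteq> 0" using part_fun_nonzero G H t by auto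
    then have "t * arc_fun G e t / part_fun G t - t * arc_fun H e t / part_fun H t =
        (t * arc_fun G e t * part_fun H t - t * arc_fun H e t * part_fun G t) / (part_fun G t * part_fun H t)"
      by (simp add: diff_frac_eq)
    then show "t * arc_fun G e t / part_fun G t - t * arc_fun H e t / part_fun H t = t ^ Suc n * g t"
      unfolding num g_def by simp
  qed
qed

text \<open>An argument as for the Schwarz lemma: the zero of order \<open>Suc n\<close> is divided
  out and the quotient is bounded on the circle of radius \<rho>. Dividing by \<open>t\<close> to
  return to \<open>arc_fun\<close> costs one power.\<close>

lemma arc_fun_close:
  assumes e: "fst e = v" and \<rho>: "norm t < \<rho>" "\<rho> < 1"
  shows "norm (arc_fun G e t / part_fun G t - arc_fun H e t / part_fun H t) \<le>
    (norm t / \<rho>) ^ n * (2 / (1 - \<rho>\<^sup>2))"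
proof -
  have pos: "\<rho> > 0" using \<rho>(1) norm_ge_zero[of t] by linarith
  have \<rho>2: "\<rho>\<^sup>2 < 1" using \<rho> pos by (simp add: abs_square_less_1)
  show ?thesis
  proof (cases "t = 0")
    case True
    then show ?thesis using arc_fun_0[OF G] arc_fun_0[OF H] pos \<rho>2 by simp
  next
    case False
    obtain g where g: "g holomorphic_on ball 0 1"
      "\<And>t. norm t < 1 \<Longrightarrow>
        t * arc_fun G e t / part_fun G t - t * arc_fun H e t / part_fun H t = t ^ Suc n * g t"
      using arc_fun_agreement[OF e] by metis
    \<comment> \<open>Twice the bound of \<open>arc_fun_bound\<close> on the circle, once for each
      graph, divided by the modulus of \<open>s ^ Suc n\<close> there.\<close>
    define M where "M = 2 * (\<rho>\<^sup>2 / (1 - \<rho>\<^sup>2)) / \<rho> ^ Suc n"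
    have "norm (g t) \<le> M"
    proof (rule maximum_modulus_frontier[of g "cball 0 \<rho>"])
      show "g holomorphic_on interior (cball 0 \<rho>)"
        using \<rho> by (intro holomorphic_on_subset[OF g(1)]) auto
      show "continuous_on (closure (cball 0 \<rho>)) g"
        using \<rho> by (intro holomorphic_on_imp_continuous_on holomorphic_on_subset[OF g(1)]) auto
      fix s :: complex assume "s \<in> frontier (cball 0 \<rho>)"
      then have s: "norm s = \<rho>" using pos by simp
      have "\<rho> ^ Suc n * norm (g s) = norm (s ^ Suc n * g s)" by (simp add: norm_mult norm_power s)
      also have "\<dots> \<le> norm (s * arc_fun G e s / part_fun G s) + norm (s * arc_fun H e s / part_fun H s)"
        using g(2)[of s] s \<rho> by (metis norm_triangle_ineq4)
      also have "\<dots> \<le> 2 * (\<rho>\<^sup>2 / (1 - \<rho>\<^sup>2))"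
        using arc_fun_bound[OF G, of s e] arc_fun_bound[OF H, of s e] s \<rho> by simp
      finally show "norm (g s) \<le> M"
        using pos unfolding M_def by (subst pos_le_divide_eq) (simp_all only: mult.commute zero_less_power)
    qed (use \<rho> in auto)
    have "arc_fun G e t / part_fun G t - arc_fun H e t / part_fun H t = t ^ n * g t"
    proof -
      have "t * (arc_fun G e t / part_fun G t - arc_fun H e t / part_fun H t) = t * (t ^ n * g t)"
        using g(2)[of t] \<rho> by (simp add: algebra_simps)
      then show ?thesis using False by simp
    qed
    then have "norm (arc_fun G e t / part_fun G t - arc_fun H e t / part_fun H t) = norm t ^ n * norm (g t)"
      by (simp add: norm_mult norm_power)
    also have "\<dots> \<le> norm t ^ n * M" using \<open>norm (g t) \<le> M\<close> by (intro mult_left_mono) auto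
    also have "\<dots> = (norm t / \<rho>) ^ n * (\<rho> * (2 / (1 - \<rho>\<^sup>2)))"
      using pos \<rho>2 by (simp add: M_def field_simps power2_eq_square)
    also have "\<dots> \<le> (norm t / \<rho>) ^ n * (1 * (2 / (1 - \<rho>\<^sup>2)))"
      using pos \<rho> \<rho>2 by (intro mult_left_mono mult_right_mono) auto
    finally show ?thesis by simp
  qed
qed

end

section \<open>The partition function of an Eulerian graph\<close>

definition abs_arcs_weight :: "'a pair_pre_digraph \<Rightarrow> 'a rel \<Rightarrow> real" where
  "abs_arcs_weight G A = (\<Prod>v\<in>pverts G. abs_weight (deg G v) (card (outs A v)))"

definition real_part_fun :: "'a pair_pre_digraph \<Rightarrow> real \<Rightarrow> real" where
  "real_part_fun G u = (\<Sum>A\<in>symsub (parcs G). abs_arcs_weight G A * u ^ card A)"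

lemma abs_arcs_weight_nonneg: "abs_arcs_weight G A \<ge> 0"
  by (simp add: abs_arcs_weight_def prod_nonneg abs_weight_nonneg)

lemma abs_arcs_weight_empty:
  "abs_arcs_weight G {} = (\<Prod>v\<in>pverts G. real (deg G v choose (deg G v div 2)))"
proof -
  have "(krawtchouk d (d div 2) 0 :: real) = real (d choose (d div 2))" for d
    by (simp add: krawtchouk_def coeff_linear_poly_power)
  then show ?thesis by (simp add: abs_arcs_weight_def abs_weight_def outs_def)
qed

lemma abs_arcs_weight_empty_pos: "abs_arcs_weight G {} > 0"
  unfolding abs_arcs_weight_empty by (intro prod_pos) (simp add: zero_less_binomial)

locale eulerian =
  fixes G :: "'a pair_pre_digraph"
  assumes eulerian: "eulerian_graph G"
begin

lemma pair_graph: "pair_graph G" and nonempty: "pverts G \<noteq> {}"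
  and even_deg: "v \<in> pverts G \<Longrightarrow> even (deg G v)"
  using eulerian by (auto simp: eulerian_graph_def finite_graph_def deg_eq_out_degree)

lemmas arcs = pair_graph_arcs[OF pair_graph]

lemma arcs_weight_eq: "A \<in> symsub (parcs G) \<Longrightarrow> arcs_weight G A = of_real (abs_arcs_weight G A)"
  unfolding arcs_weight_def abs_arcs_weight_def of_real_prod
  using even_deg arcs(2)
  by (intro prod.cong vertex_weight_even) (auto simp: deg_def symsub_def intro!: card_mono outs_mono)

lemma part_fun_of_real: "part_fun G (of_real u) = of_real (real_part_fun G u)"
  unfolding part_fun_def real_part_fun_def by (simp add: arcs_weight_eq)

lemma real_part_fun_pos:
  assumes "u \<ge> 0"
  shows "real_part_fun G u > 0"
proof -
  have "0 < abs_arcs_weight G {} * u ^ card ({} :: 'a rel)" using abs_arcs_weight_empty_pos by simp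
  also have "\<dots> \<le> real_part_fun G u"
    unfolding real_part_fun_def using arcs assms
    by (intro member_le_sum) (auto simp: abs_arcs_weight_nonneg)
  finally show ?thesis .
qed

lemma real_part_fun_0: "real_part_fun G 0 = abs_arcs_weight G {}"
proof -
  have "real_part_fun G 0 = (\<Sum>A\<in>{{}}. abs_arcs_weight G A * 0 ^ card A)"
    unfolding real_part_fun_def
  proof (intro sum.mono_neutral_right ballI)
    fix A assume "A \<in> symsub (parcs G) - {{}}"
    then have "card A \<noteq> 0" using arcs(2) by (auto simp: symsub_def card_eq_0_iff dest: finite_subset)
    then show "abs_arcs_weight G A * 0 ^ card A = 0" by simp
  qed (use arcs in auto)
  then show ?thesis by simp
qed

lemma real_part_fun_mono:
  "0 \<le> u \<Longrightarrow> u \<le> w \<Longrightarrow> real_part_fun G u \<le> real_part_fun G w"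
  unfolding real_part_fun_def
  by (intro sum_mono mult_left_mono power_mono abs_arcs_weight_nonneg) auto

lemma real_part_fun_scale:
  assumes "0 \<le> u" "u \<le> 1"
  shows "u ^ card (parcs G) * real_part_fun G 1 \<le> real_part_fun G u"
  unfolding real_part_fun_def sum_distrib_left
proof (rule sum_mono)
  fix A assume "A \<in> symsub (parcs G)"
  then have "card A \<le> card (parcs G)" using arcs by (auto simp: symsub_def intro: card_mono)
  then have "u ^ card (parcs G) \<le> u ^ card A" using assms by (rule power_decreasing)
  then show "u ^ card (parcs G) * (abs_arcs_weight G A * 1 ^ card A) \<le> abs_arcs_weight G A * u ^ card A"
    using abs_arcs_weight_nonneg[of G A] by (simp add: mult.commute mult_left_mono)
qed

lemma real_part_fun_1:
  "real_part_fun G 1 = real (num_eulerian_orientations G) * 2 ^ (card (parcs G) div 2)"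
proof -
  have "complex_of_real (real_part_fun G 1) =
      of_real (real (num_eulerian_orientations G) * 2 ^ (card (parcs G) div 2))"
    using part_fun_1[OF pair_graph even_deg] part_fun_of_real[of 1] by simp
  then show ?thesis by (simp only: of_real_eq_iff)
qed

lemma num_eulerian_orientations_pos: "num_eulerian_orientations G > 0"
  using real_part_fun_pos[of 1] real_part_fun_1 by (cases "num_eulerian_orientations G") auto

lemma card_arcs: "card (parcs G) = (\<Sum>v\<in>pverts G. deg G v)"
  using sum_outs[OF arcs(1,2,6), of "\<lambda>_. 1::nat"] by (simp add: deg_def)

lemma even_card_arcs: "even (card (parcs G))"
  unfolding card_arcs using even_deg by (intro dvd_sum) auto

text \<open>The power of two contributes \<open>ln 2\<close> for each edge; splitting this evenly
  between the two ends gives a sum over the vertices.\<close>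

lemma ln_real_part_fun_1:
  "ln (real (num_eulerian_orientations G)) = ln (real_part_fun G 1) - (\<Sum>v\<in>pverts G. real (deg G v) / 2 * ln 2)"
proof -
  have "ln (real_part_fun G 1) =
      ln (real (num_eulerian_orientations G)) + real (card (parcs G) div 2) * ln 2"
    unfolding real_part_fun_1 using num_eulerian_orientations_pos
    by (subst ln_mult) (auto simp: ln_realpow)
  also have "real (card (parcs G) div 2) = real (card (parcs G)) / 2"
    using even_card_arcs by (simp add: real_of_nat_div)
  also have "\<dots> * ln 2 = (\<Sum>v\<in>pverts G. real (deg G v) / 2 * ln 2)"
    by (simp add: card_arcs sum_distrib_right sum_divide_distrib)
  finally show ?thesis by simp
qed

lemma ln_real_part_fun_close:
  assumes "0 < u" "u \<le> 1"
  shows "\<bar>ln (real_part_fun G 1) - ln (real_part_fun G u)\<bar> \<le> real (card (parcs G)) * ln (1 / u)"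
proof -
  have pos: "real_part_fun G 1 > 0" "real_part_fun G u > 0" using real_part_fun_pos assms by auto
  have "ln (real_part_fun G u) \<le> ln (real_part_fun G 1)"
    using real_part_fun_mono[of u 1] assms pos by simp
  moreover have "ln (u ^ card (parcs G) * real_part_fun G 1) \<le> ln (real_part_fun G u)"
    using real_part_fun_scale[of u] assms pos by (subst ln_le_cancel_iff) auto
  then have "real (card (parcs G)) * ln u + ln (real_part_fun G 1) \<le> ln (real_part_fun G u)"
    using assms pos by (simp add: ln_mult ln_realpow)
  ultimately show ?thesis using assms by (simp add: ln_div abs_if)
qed

lemma log_derivative:
  assumes "0 \<le> u" "u < 1"
  shows "((\<lambda>u. ln (real_part_fun G u)) has_real_derivative
    (\<Sum>e\<in>parcs G. Re (arc_fun G e (of_real u) / part_fun G (of_real u)))) (at u)"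
proof -
  define D where "D = (\<Sum>A\<in>symsub (parcs G). abs_arcs_weight G A * (real (card A) * u ^ (card A - 1)))"
  have pos: "real_part_fun G u > 0" using real_part_fun_pos assms by simp
  have "(real_part_fun G has_real_derivative D) (at u)"
    unfolding real_part_fun_def[abs_def] D_def by (auto intro!: derivative_eq_intros sum.cong)
  then have "((\<lambda>u. ln (real_part_fun G u)) has_real_derivative D / real_part_fun G u) (at u)"
    using pos by (auto intro!: derivative_eq_intros)
  moreover have "(\<Sum>e\<in>parcs G. arc_fun G e (of_real u)) = of_real D"
  proof -
    have "(\<Sum>e\<in>parcs G. arc_fun G e (of_real u)) = (\<Sum>e\<in>parcs G. \<Sum>A\<in>symsub (parcs G).
        if e \<in> A then of_real (abs_arcs_weight G A * u ^ (card A - 1)) else 0)"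
      unfolding arc_fun_def using arcs
      by (intro sum.cong sum.mono_neutral_cong_left) (auto simp: arcs_weight_eq)
    also have "\<dots> = (\<Sum>A\<in>symsub (parcs G). \<Sum>e\<in>parcs G.
        if e \<in> A then of_real (abs_arcs_weight G A * u ^ (card A - 1)) else 0)"
      by (rule sum.swap)
    also have "\<dots> = (\<Sum>A\<in>symsub (parcs G). \<Sum>e\<in>A. of_real (abs_arcs_weight G A * u ^ (card A - 1)))"
      using arcs by (intro sum.cong sum.mono_neutral_cong_right) (auto simp: symsub_def)
    also have "\<dots> = of_real D" by (simp add: D_def mult_ac)
    finally show ?thesis .
  qed
  then have "(\<Sum>e\<in>parcs G. Re (arc_fun G e (of_real u) / part_fun G (of_real u))) = D / real_part_fun G u"
    unfolding part_fun_of_real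
    by (metis Re_complex_of_real Re_sum of_real_divide sum_divide_distrib)
  ultimately show ?thesis by simp
qed

end

section \<open>Integrated marginals and the contribution of a root\<close>

definition arc_integrand :: "'a pair_pre_digraph \<Rightarrow> 'a \<times> 'a \<Rightarrow> real \<Rightarrow> real" where
  "arc_integrand G e u = Re (arc_fun G e (of_real u) / part_fun G (of_real u))"

lemma continuous_arc_integrand:
  assumes "pair_graph G" "z < 1"
  shows "continuous_on {0..z} (arc_integrand G e)"
  unfolding arc_integrand_def[abs_def] arc_fun_def part_fun_def
  using part_fun_nonzero[OF assms(1), unfolded part_fun_def] assms(2)
  by (intro continuous_intros) auto

text \<open>
  The share of the root in \<open>ln (real_part_fun G z) - (card (parcs G) / 2) * ln 2\<close>: the integrals come from
  \<open>ln (real_part_fun G z) - ln (real_part_fun G 0)\<close>, the binomial coefficient from \<open>real_part_fun G 0\<close>.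
\<close>

definition root_term :: "real \<Rightarrow> 'a rooted_graph \<Rightarrow> real" where
  "root_term z A = (\<Sum>e\<in>outs (parcs (fst A)) (snd A). integral {0..z} (arc_integrand (fst A) e)) +
     ln (real (deg (fst A) (snd A) choose (deg (fst A) (snd A) div 2))) -
     real (deg (fst A) (snd A)) / 2 * ln 2"

lemma abs_arc_integrand_le:
  assumes "pair_graph G" "0 \<le> u" "u \<le> z" "z < 1"
  shows "\<bar>arc_integrand G e u\<bar> \<le> 1 / (1 - z\<^sup>2)"
proof (cases "u = 0")
  case True
  have "z\<^sup>2 < 1" using assms by (simp add: abs_square_less_1)
  then show ?thesis using True arc_fun_0[OF assms(1)] by (simp add: arc_integrand_def)
next
  case False
  then have u: "u > 0" using assms by simp
  have z: "z\<^sup>2 < 1" "u\<^sup>2 \<le> z\<^sup>2" using assms by (auto simp: abs_square_less_1 intro: power_mono)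
  let ?w = "arc_fun G e (of_real u) / part_fun G (of_real u)"
  have "u * norm ?w = norm (of_real u * arc_fun G e (of_real u) / part_fun G (of_real u))"
    using u by (simp add: norm_mult norm_divide)
  also have "\<dots> \<le> u\<^sup>2 / (1 - u\<^sup>2)"
    using arc_fun_bound[OF assms(1), of "of_real u" e] u assms by simp
  also have "\<dots> = u * (u / (1 - u\<^sup>2))" by (simp add: power2_eq_square)
  finally have "norm ?w \<le> u / (1 - u\<^sup>2)" by (rule mult_left_le_imp_le) (rule u)
  also have "\<dots> \<le> 1 / (1 - z\<^sup>2)" using u z assms by (intro frac_le) auto
  finally show ?thesis
    using abs_Re_le_cmod[of ?w] by (simp add: arc_integrand_def)
qed

lemma abs_root_term_le:
  assumes G: "pair_graph (fst A)" and z: "0 \<le> z" "z < 1" and deg: "deg (fst A) (snd A) \<le> \<Delta>"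
  shows "\<bar>root_term z A\<bar> \<le> real \<Delta> * (1 / (1 - z\<^sup>2)) + real \<Delta> * ln 2"
proof -
  let ?d = "deg (fst A) (snd A)"
  have z2: "z\<^sup>2 < 1" using z by (simp add: abs_square_less_1)
  have "\<bar>integral {0..z} (arc_integrand (fst A) e)\<bar> \<le> 1 / (1 - z\<^sup>2)" for e
  proof -
    have "norm (integral {0..z} (arc_integrand (fst A) e)) \<le> 1 / (1 - z\<^sup>2) * (z - 0)"
      using abs_arc_integrand_le[OF G] z by (intro integral_bound continuous_arc_integrand G) auto
    also have "\<dots> \<le> 1 / (1 - z\<^sup>2)" using z z2 by (intro mult_right_le_one_le) auto
    finally show ?thesis by simp
  qed
  then have "\<bar>\<Sum>e\<in>outs (parcs (fst A)) (snd A). integral {0..z} (arc_integrand (fst A) e)\<bar> \<le>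
      real ?d * (1 / (1 - z\<^sup>2))"
    unfolding deg_def by (intro order_trans[OF sum_abs] sum_bounded_above)
  also have "\<dots> \<le> real \<Delta> * (1 / (1 - z\<^sup>2))" using deg z2 by (intro mult_right_mono) auto
  finally have 1: "\<bar>\<Sum>e\<in>outs (parcs (fst A)) (snd A). integral {0..z} (arc_integrand (fst A) e)\<bar> \<le> \<dots>" .
  have "?d choose (?d div 2) \<ge> 1" by (simp add: Suc_le_eq zero_less_binomial)
  then have "0 \<le> ln (real (?d choose (?d div 2)))" by simp
  moreover have "ln (real (?d choose (?d div 2))) \<le> ln (2 ^ ?d)"
  proof (subst ln_le_cancel_iff)
    have "?d choose (?d div 2) \<le> 2 ^ ?d" by (rule binomial_le_pow2)
    then show "real (?d choose (?d div 2)) \<le> 2 ^ ?d" by (metis of_nat_le_iff of_nat_numeral of_nat_power)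
  qed (auto simp: zero_less_binomial)
  then have "ln (real (?d choose (?d div 2))) \<le> real ?d * ln 2" by (simp add: ln_realpow)
  moreover have "real ?d * ln 2 \<le> real \<Delta> * ln 2" using deg by simp
  moreover have "0 \<le> real ?d * ln 2" by simp
  ultimately show ?thesis using 1 unfolding root_term_def times_divide_eq_left by linarith
qed

section \<open>Balls as rooted graphs\<close>

lemma ball_verts_subset: "pair_graph G \<Longrightarrow> ball_verts G r v \<subseteq> pverts G"
proof
  fix x assume "pair_graph G" "x \<in> ball_verts G r v"
  then interpret pair_graph G by simp
  obtain p where "awalk v p x" using \<open>x \<in> ball_verts G r v\<close> by (auto simp: ball_verts_def)
  then show "x \<in> pverts G" by (rule awalk_last_in_verts)
qed

lemma rooted_ball_simps [simp]:
  "snd (rooted_ball G r v) = v" "pverts (fst (rooted_ball G r v)) = ball_verts G r v"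
  "parcs (fst (rooted_ball G r v)) = parcs G \<inter> ball_verts G r v \<times> ball_verts G r v"
  by (simp_all add: rooted_ball_def)

lemma pair_graph_rooted_ball:
  assumes "pair_graph G"
  shows "pair_graph (fst (rooted_ball G r v))"
proof -
  note G = pair_graph_arcs[OF assms]
  show ?thesis
  proof
    show "finite (pverts (fst (rooted_ball G r v)))"
      using finite_subset[OF ball_verts_subset[OF assms] G(1)] by simp
    show "symmetric (with_proj (fst (rooted_ball G r v)))"
      using G(3) by (auto simp: symmetric_def sym_def)
    show "fst e \<noteq> snd e" if "e \<in> parcs (fst (rooted_ball G r v))" for e
      using that G(4) by (cases e) (auto simp: irrefl_def)
  qed (use G in auto)
qed

lemma ball_verts_root: "pair_graph G \<Longrightarrow> v \<in> pverts G \<Longrightarrow> v \<in> ball_verts G r v"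
  by (auto simp: ball_verts_eq intro!: exI[of _ 0])

text \<open>The heads of arcs leaving the ball of radius \<open>r\<close> have distance at most
  \<open>r + 1\<close> from the centre.\<close>

lemma outs_rooted_ball:
  assumes "pair_graph G" "v \<in> pverts G" "x \<in> ball_verts G r v"
  shows "outs (parcs (fst (rooted_ball G (Suc r) v))) x = outs (parcs G) x"
proof -
  obtain k where k: "k \<le> r" "(v, x) \<in> parcs G ^^ k"
    using assms by (auto simp: ball_verts_eq)
  have "(v, y) \<in> parcs G ^^ Suc k" if "(x, y) \<in> parcs G" for y
    using that k by (auto intro: relpow_Suc_I)
  then have "y \<in> ball_verts G (Suc r) v" if "(x, y) \<in> parcs G" for y
    using that k(1) unfolding ball_verts_eq[OF assms(1,2)] using Suc_le_mono by blast
  moreover have "x \<in> ball_verts G (Suc r) v"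
    using k unfolding ball_verts_eq[OF assms(1,2)] using le_SucI by blast
  ultimately show ?thesis by (auto simp: outs_def)
qed

lemma deg_rooted_ball:
  assumes "pair_graph G" "v \<in> pverts G" "x \<in> ball_verts G r v"
  shows "deg (fst (rooted_ball G (Suc r) v)) x = deg G x"
  unfolding deg_def outs_rooted_ball[OF assms] ..

lemma local_agreement_rooted_ball:
  assumes "pair_graph G" "v \<in> pverts G"
  shows "local_agreement G (fst (rooted_ball G (Suc r) v)) v r (ball_verts G r v)"
proof (rule local_agreement.intro)
  show "ball_verts G r v \<subseteq> pverts (fst (rooted_ball G (Suc r) v))"
    using assms by (auto simp: ball_verts_eq intro: le_SucI)
  then show "(x, y) \<in> parcs (fst (rooted_ball G (Suc r) v))"
    if "(x, y) \<in> parcs G" "x \<in> ball_verts G r v" "y \<in> ball_verts G r v" for x y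
    using that by auto
  show "x \<in> ball_verts G r v" if "k \<le> r" "(v, x) \<in> parcs G ^^ k" for x k
    using that assms by (auto simp: ball_verts_eq)
qed (use assms ball_verts_subset[OF assms(1)] deg_rooted_ball pair_graph_rooted_ball in auto)

section \<open>Approximating the entropy by an average of root terms\<close>

lemma integral_arc_integrand_close:
  assumes G: "pair_graph G" "v \<in> pverts G" and e: "fst e = v" and z: "0 < z" "z < \<rho>" "\<rho> < 1"
  shows "\<bar>integral {0..z} (arc_integrand G e) -
      integral {0..z} (arc_integrand (fst (rooted_ball G (Suc r) v)) e)\<bar> \<le>
    (z / \<rho>) ^ r * (2 / (1 - \<rho>\<^sup>2))"
proof -
  let ?H = "fst (rooted_ball G (Suc r) v)"
  interpret local_agreement G ?H v r "ball_verts G r v"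
    using G by (rule local_agreement_rooted_ball)
  have cont: "continuous_on {0..z} (arc_integrand G e)" "continuous_on {0..z} (arc_integrand ?H e)"
    using z G H by (auto intro: continuous_arc_integrand)
  have \<rho>2: "\<rho>\<^sup>2 < 1" using z by (simp add: abs_square_less_1)
  define M where "M = (z / \<rho>) ^ r * (2 / (1 - \<rho>\<^sup>2))"
  have M: "0 \<le> M" using z \<rho>2 by (simp add: M_def)
  have "\<bar>arc_integrand G e u - arc_integrand ?H e u\<bar> \<le> M" if u: "u \<in> {0..z}" for u
  proof -
    let ?w = "arc_fun G e (of_real u) / part_fun G (of_real u) -
      arc_fun ?H e (of_real u) / part_fun ?H (of_real u)"
    have "norm ?w \<le> (u / \<rho>) ^ r * (2 / (1 - \<rho>\<^sup>2))"
      using arc_fun_close[OF e, of "of_real u" \<rho>] u z by simp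
    also have "\<dots> \<le> M"
      unfolding M_def using u z \<rho>2 by (intro mult_right_mono power_mono divide_right_mono) auto
    finally show ?thesis
      using abs_Re_le_cmod[of ?w] by (simp add: arc_integrand_def)
  qed
  then have "norm (integral {0..z} (\<lambda>u. arc_integrand G e u - arc_integrand ?H e u)) \<le> M * (z - 0)"
    using z cont by (intro integral_bound continuous_intros) auto
  also have "\<dots> \<le> M" using z M by (simp add: mult_left_le)
  finally show ?thesis
    using cont by (simp add: M_def integral_diff integrable_continuous_interval)
qed

lemma (in eulerian) ln_real_part_fun_eq:
  assumes "0 \<le> z" "z < 1"
  shows "ln (real_part_fun G z) = (\<Sum>v\<in>pverts G. ln (real (deg G v choose (deg G v div 2)))) +
    (\<Sum>v\<in>pverts G. \<Sum>e\<in>outs (parcs G) v. integral {0..z} (arc_integrand G e))"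
proof -
  have "((\<lambda>u. \<Sum>e\<in>parcs G. arc_integrand G e u) has_integral
      ln (real_part_fun G z) - ln (real_part_fun G 0)) {0..z}"
    using assms log_derivative
    by (intro fundamental_theorem_of_calculus)
      (auto simp: arc_integrand_def has_real_derivative_iff_has_vector_derivative[symmetric]
        intro: has_field_derivative_at_within)
  moreover have "((\<lambda>u. \<Sum>e\<in>parcs G. arc_integrand G e u) has_integral
      (\<Sum>e\<in>parcs G. integral {0..z} (arc_integrand G e))) {0..z}"
    using arcs assms pair_graph
    by (intro has_integral_sum) (auto intro!: integrable_continuous_interval continuous_arc_integrand)
  ultimately have "ln (real_part_fun G z) - ln (real_part_fun G 0) =
      (\<Sum>e\<in>parcs G. integral {0..z} (arc_integrand G e))"
    by (rule has_integral_unique)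
  moreover have "ln (real_part_fun G 0) = (\<Sum>v\<in>pverts G. ln (real (deg G v choose (deg G v div 2))))"
    unfolding real_part_fun_0 abs_arcs_weight_empty
    using arcs by (intro ln_prod) (auto simp: zero_less_binomial)
  ultimately show ?thesis by (simp add: sum_outs[OF arcs(1,2,6)])
qed

text \<open>Two errors occur, both proportional to the number of arcs: moving from 1 to
  \<open>z\<close>, and replacing the marginals of \<open>G\<close> by those of balls. Bounding the
  arcs by \<Delta> times the number of vertices makes the normalised error independent of
  \<open>G\<close>.\<close>

lemma (in eulerian) root_term_approx:
  assumes deg: "max_degree_le \<Delta> G" and z: "0 < z" "z < \<rho>" "\<rho> < 1"
  shows "\<bar>eulerian_entropy G -
      (\<Sum>v\<in>pverts G. root_term z (rooted_ball G (Suc r) v)) / real (card (pverts G))\<bar> \<le>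
    real \<Delta> * (ln (1 / z) + (z / \<rho>) ^ r * (2 / (1 - \<rho>\<^sup>2)))"
proof -
  define N where "N = real (card (pverts G))"
  have N: "N > 0" using arcs nonempty by (simp add: N_def card_gt_0_iff)
  define M where "M = (z / \<rho>) ^ r * (2 / (1 - \<rho>\<^sup>2))"
  have \<rho>2: "\<rho>\<^sup>2 < 1" using z by (simp add: abs_square_less_1)
  have M: "0 \<le> M" using z \<rho>2 by (simp add: M_def)
  let ?I = "\<lambda>G e. integral {0..z} (arc_integrand G e)"
  let ?H = "\<lambda>v. fst (rooted_ball G (Suc r) v)"
  have "real (card (parcs G)) = (\<Sum>v\<in>pverts G. real (deg G v))" by (simp add: card_arcs)
  also have "\<dots> \<le> (\<Sum>v\<in>pverts G. real \<Delta>)"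
    using deg by (intro sum_mono) (auto simp: max_degree_le_def deg_eq_out_degree)
  finally have arcs_le: "real (card (parcs G)) \<le> N * real \<Delta>" by (simp add: N_def)
  have root: "root_term z (rooted_ball G (Suc r) v) = (\<Sum>e\<in>outs (parcs G) v. ?I (?H v) e) +
      ln (real (deg G v choose (deg G v div 2))) - real (deg G v) / 2 * ln 2" if "v \<in> pverts G" for v
    using that pair_graph ball_verts_root[OF pair_graph that]
    by (simp add: root_term_def outs_rooted_ball deg_rooted_ball del: rooted_ball_simps(3))
  have "N * eulerian_entropy G = ln (real (num_eulerian_orientations G))"
    using N by (simp add: eulerian_entropy_def N_def)
  also have "\<dots> = ln (real_part_fun G 1) - ln (real_part_fun G z) +
      (\<Sum>v\<in>pverts G. (\<Sum>e\<in>outs (parcs G) v. ?I G e) +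
        ln (real (deg G v choose (deg G v div 2))) - real (deg G v) / 2 * ln 2)"
    unfolding ln_real_part_fun_1 using ln_real_part_fun_eq[of z] z
    by (simp add: sum.distrib sum_subtractf)
  finally have "N * eulerian_entropy G - (\<Sum>v\<in>pverts G. root_term z (rooted_ball G (Suc r) v)) =
      ln (real_part_fun G 1) - ln (real_part_fun G z) +
      (\<Sum>v\<in>pverts G. \<Sum>e\<in>outs (parcs G) v. ?I G e - ?I (?H v) e)"
    by (simp add: root sum.distrib sum_subtractf)
  also have "\<bar>\<dots>\<bar> \<le> real (card (parcs G)) * ln (1 / z) + real (card (parcs G)) * M"
  proof (intro order_trans[OF abs_triangle_ineq] add_mono)
    show "\<bar>ln (real_part_fun G 1) - ln (real_part_fun G z)\<bar> \<le> real (card (parcs G)) * ln (1 / z)"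
      using z by (intro ln_real_part_fun_close) auto
    have "\<bar>\<Sum>v\<in>pverts G. \<Sum>e\<in>outs (parcs G) v. ?I G e - ?I (?H v) e\<bar> \<le>
        (\<Sum>v\<in>pverts G. \<Sum>e\<in>outs (parcs G) v. M)"
    proof (intro order_trans[OF sum_abs] sum_mono)
      fix v e assume "v \<in> pverts G" "e \<in> outs (parcs G) v"
      then show "\<bar>?I G e - ?I (?H v) e\<bar> \<le> M"
        unfolding M_def using z pair_graph
        by (intro integral_arc_integrand_close) (auto simp: outs_def)
    qed
    also have "\<dots> = real (card (parcs G)) * M"
      by (simp add: card_arcs deg_def sum_distrib_right)
    finally show "\<bar>\<Sum>v\<in>pverts G. \<Sum>e\<in>outs (parcs G) v. ?I G e - ?I (?H v) e\<bar> \<le>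
      real (card (parcs G)) * M" .
  qed
  also have "\<dots> = real (card (parcs G)) * (ln (1 / z) + M)" by (simp add: distrib_left)
  also have "\<dots> \<le> N * real \<Delta> * (ln (1 / z) + M)"
    using arcs_le M z by (intro mult_right_mono add_nonneg_nonneg) auto
  finally have "\<bar>N * eulerian_entropy G - (\<Sum>v\<in>pverts G. root_term z (rooted_ball G (Suc r) v))\<bar> \<le>
    N * (real \<Delta> * (ln (1 / z) + M))" by (simp add: mult.assoc)
  then have "\<bar>N * eulerian_entropy G - (\<Sum>v\<in>pverts G. root_term z (rooted_ball G (Suc r) v))\<bar> / N \<le>
    real \<Delta> * (ln (1 / z) + M)" using N by (simp add: pos_divide_le_eq mult.commute)
  also have "\<bar>N * eulerian_entropy G - (\<Sum>v\<in>pverts G. root_term z (rooted_ball G (Suc r) v))\<bar> / N =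
      \<bar>(N * eulerian_entropy G - (\<Sum>v\<in>pverts G. root_term z (rooted_ball G (Suc r) v))) / N\<bar>"
    using N by simp
  also have "(N * eulerian_entropy G - (\<Sum>v\<in>pverts G. root_term z (rooted_ball G (Suc r) v))) / N =
      eulerian_entropy G - (\<Sum>v\<in>pverts G. root_term z (rooted_ball G (Suc r) v)) / N"
    using N by (simp add: diff_divide_distrib)
  finally show ?thesis by (simp only: N_def M_def)
qed

section \<open>Rooted isomorphisms\<close>

text \<open>Both graphs have the projections as tail and head maps, which forces the arc map of an
  isomorphism to be induced by its vertex map.\<close>

lemma rooted_isoE:
  assumes "rooted_iso A B"
  obtains f where "inj_on f (pverts (fst A))" "pverts (fst B) = f ` pverts (fst A)"
    "parcs (fst B) = map_prod f f ` parcs (fst A)" "snd B = f (snd A)"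
proof -
  obtain h where h: "pre_digraph.digraph_isomorphism (with_proj (fst A)) h"
    "with_proj (fst B) = app_iso h (with_proj (fst A))" "snd B = iso_verts h (snd A)"
    using assms by (auto simp: rooted_iso_def)
  let ?f = "iso_verts h"
  have proj: "iso_tail h = fst" "iso_head h = snd"
    using arg_cong[OF h(2), of tail] arg_cong[OF h(2), of head] by simp_all
  have "iso_arcs h e = map_prod ?f ?f e" if "e \<in> parcs (fst A)" for e
    using h(1) that by (cases e, cases "iso_arcs h e")
      (auto simp: pre_digraph.digraph_isomorphism_def proj)
  then have "iso_arcs h ` parcs (fst A) = map_prod ?f ?f ` parcs (fst A)" by (intro image_cong) auto
  then have "parcs (fst B) = map_prod ?f ?f ` parcs (fst A)"
    using arg_cong[OF h(2), of arcs] by simp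
  moreover have "pverts (fst B) = ?f ` pverts (fst A)"
    using arg_cong[OF h(2), of verts] by simp
  moreover have "inj_on ?f (pverts (fst A))"
    using h(1) by (simp add: pre_digraph.digraph_isomorphism_def)
  ultimately show thesis using that h(3) by blast
qed

lemma rooted_isoI:
  assumes "pair_graph (fst A)" and inj: "inj_on f (pverts (fst A))"
    and B: "pverts (fst B) = f ` pverts (fst A)" "parcs (fst B) = map_prod f f ` parcs (fst A)"
      "snd B = f (snd A)"
  shows "rooted_iso A B"
proof -
  interpret pair_graph "fst A" by fact
  let ?h = "\<lparr>iso_verts = f, iso_arcs = map_prod f f, iso_head = snd, iso_tail = fst\<rparr>"
  have "inj_on (map_prod f f) (parcs (fst A))"
    using map_prod_inj_on[OF inj inj] pair_graph_arcs(5)[OF assms(1)] by (rule inj_on_subset)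
  then have "digraph_isomorphism ?h"
    unfolding digraph_isomorphism_def using inj wf_digraph_axioms by auto
  moreover have "with_proj (fst B) = app_iso ?h (with_proj (fst A))"
    by (simp add: with_proj_def app_iso_def B)
  ultimately show ?thesis unfolding rooted_iso_def using B(3) by (intro exI[of _ ?h]) auto
qed

text \<open>The class on which \<open>rooted_iso\<close> is used as an equivalence relation; it
  contains all balls and is closed under isomorphism.\<close>

definition root_graph :: "'a rooted_graph \<Rightarrow> bool" where
  "root_graph A \<longleftrightarrow> pair_graph (fst A) \<and> snd A \<in> pverts (fst A)"

lemma root_graph_rooted_ball:
  "pair_graph G \<Longrightarrow> v \<in> pverts G \<Longrightarrow> root_graph (rooted_ball G r v)"
  by (auto simp: root_graph_def pair_graph_rooted_ball ball_verts_root simp del: rooted_ball_simps(3))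

lemma root_graph_iso:
  assumes "root_graph A" "rooted_iso A B"
  shows "root_graph B"
proof -
  obtain f where f: "inj_on f (pverts (fst A))" "pverts (fst B) = f ` pverts (fst A)"
    "parcs (fst B) = map_prod f f ` parcs (fst A)" "snd B = f (snd A)"
    using assms(2) by (rule rooted_isoE)
  have A: "pair_graph (fst A)" using assms by (simp add: root_graph_def)
  note A' = pair_graph_arcs[OF A]
  have "pair_graph (fst B)"
  proof
    show "finite (pverts (fst B))" "finite (parcs (fst B))" using A' f by auto
    show "fst e \<in> pverts (fst B)" "snd e \<in> pverts (fst B)" if "e \<in> parcs (fst B)" for e
      using that A'(5) f by auto
    show "symmetric (with_proj (fst B))"
      using A'(3) f(3) unfolding symmetric_def sym_def by (force simp: image_iff)
    show "fst e \<noteq> snd e" if e: "e \<in> parcs (fst B)" for e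
    proof -
      obtain x y where xy: "(x, y) \<in> parcs (fst A)" "e = (f x, f y)" using e f(3) by auto
      moreover have "x \<noteq> y" "x \<in> pverts (fst A)" "y \<in> pverts (fst A)"
        using A'(4,5) xy by (auto simp: irrefl_def)
      ultimately show ?thesis using f(1) by (auto dest: inj_onD)
    qed
  qed
  then show ?thesis using assms f by (auto simp: root_graph_def)
qed

lemma rooted_iso_sym:
  assumes A: "root_graph A" and iso: "rooted_iso A B"
  shows "rooted_iso B A"
proof -
  obtain f where f: "inj_on f (pverts (fst A))" "pverts (fst B) = f ` pverts (fst A)"
    "parcs (fst B) = map_prod f f ` parcs (fst A)" "snd B = f (snd A)"
    using iso by (rule rooted_isoE)
  define g where "g = the_inv_into (pverts (fst A)) f"
  have g: "g (f x) = x" if "x \<in> pverts (fst A)" for x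
    using f(1) that by (simp add: g_def the_inv_into_f_f)
  have arcs: "parcs (fst A) \<subseteq> pverts (fst A) \<times> pverts (fst A)"
    using A pair_graph_arcs(5) by (auto simp: root_graph_def)
  show ?thesis
  proof (rule rooted_isoI[where f = g])
    show "pair_graph (fst B)" using root_graph_iso[OF A iso] by (simp add: root_graph_def)
    show "inj_on g (pverts (fst B))" using g f(2) by (auto simp: inj_on_def)
    show "pverts (fst A) = g ` pverts (fst B)" using g by (force simp: f(2) image_iff)
    have "(map_prod g g \<circ> map_prod f f) ` parcs (fst A) = id ` parcs (fst A)"
      using g arcs by (intro image_cong) auto
    then show "parcs (fst A) = map_prod g g ` parcs (fst B)" by (simp add: f(3) image_comp)
    show "snd A = g (snd B)" using A f(4) g by (simp add: root_graph_def)
  qed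
qed

lemma rooted_iso_trans:
  assumes A: "root_graph A" and iso: "rooted_iso A B" "rooted_iso B C"
  shows "rooted_iso A C"
proof -
  obtain f where f: "inj_on f (pverts (fst A))" "pverts (fst B) = f ` pverts (fst A)"
    "parcs (fst B) = map_prod f f ` parcs (fst A)" "snd B = f (snd A)"
    using iso(1) by (rule rooted_isoE)
  obtain g where g: "inj_on g (pverts (fst B))" "pverts (fst C) = g ` pverts (fst B)"
    "parcs (fst C) = map_prod g g ` parcs (fst B)" "snd C = g (snd B)"
    using iso(2) by (rule rooted_isoE)
  show ?thesis
    by (rule rooted_isoI[where f = "g \<circ> f"])
      (use A f g in \<open>auto simp: root_graph_def comp_inj_on image_comp map_prod.comp\<close>)
qed

text \<open>Degrees, weights and symmetric arc sets are all transported along the vertex map. This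
  makes the local term a function of the isomorphism type, as an estimator requires.\<close>

lemma root_term_iso:
  assumes A: "root_graph A" and iso: "rooted_iso A B"
  shows "root_term z B = root_term z A"
proof -
  obtain f where f: "inj_on f (pverts (fst A))" "pverts (fst B) = f ` pverts (fst A)"
    "parcs (fst B) = map_prod f f ` parcs (fst A)" "snd B = f (snd A)"
    using iso by (rule rooted_isoE)
  have gA: "pair_graph (fst A)" and root: "snd A \<in> pverts (fst A)" using A by (auto simp: root_graph_def)
  note A' = pair_graph_arcs[OF gA]
  let ?F = "map_prod f f"
  let ?S = "parcs (fst A)" and ?V = "pverts (fst A)"
  have injF: "inj_on ?F (?V \<times> ?V)" using map_prod_inj_on[OF f(1) f(1)] .
  then have injS: "inj_on ?F ?S" using A'(5) by (rule inj_on_subset)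
  have outs: "outs (?F ` C) (f v) = ?F ` outs C v" if "C \<subseteq> ?S" "v \<in> ?V" for C v
  proof -
    have "fst p = v" if "p \<in> C" "f (fst p) = f v" for p
      using that \<open>C \<subseteq> ?S\<close> \<open>v \<in> ?V\<close> A'(6) f(1) by (intro inj_onD[OF f(1) that(2)]) auto
    then show ?thesis unfolding outs_def by auto
  qed
  have card: "card (?F ` C) = card C" if "C \<subseteq> ?S" for C
    using that injS by (intro card_image) (rule inj_on_subset)
  have card_outs: "card (outs (?F ` C) (f v)) = card (outs C v)" if "C \<subseteq> ?S" "v \<in> ?V" for C v
    unfolding outs[OF that] using that outs_subset[of C v] by (intro card) auto
  have deg: "deg (fst B) (f v) = deg (fst A) v" if "v \<in> ?V" for v
    using card_outs[OF order_refl that] by (simp add: deg_def f(3))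
  have weight: "arcs_weight (fst B) (?F ` C) = arcs_weight (fst A) C" if "C \<subseteq> ?S" for C
    unfolding arcs_weight_def f(2) prod.reindex[OF f(1)]
    using that by (intro prod.cong) (auto simp: deg card_outs)
  have symF: "sym (?F ` C) \<longleftrightarrow> sym C" if C: "C \<subseteq> ?S" for C
  proof
    assume sym: "sym C"
    show "sym (?F ` C)"
    proof (rule symI)
      fix x y assume "(x, y) \<in> ?F ` C"
      then obtain a b where ab: "(a, b) \<in> C" "x = f a" "y = f b" by auto
      then have "(b, a) \<in> C" using sym by (blast dest: symD)
      then show "(y, x) \<in> ?F ` C" using ab(2,3) by force
    qed
  next
    assume sym: "sym (?F ` C)"
    show "sym C"
    proof (rule symI)
      fix x y assume xy: "(x, y) \<in> C"
      then have "?F (x, y) \<in> ?F ` C" by (rule imageI)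
      then have "(f y, f x) \<in> ?F ` C" unfolding map_prod_simp by (rule symD[OF sym])
      then obtain p where "(f y, f x) = ?F p" and p: "p \<in> C" by (rule imageE)
      then have "?F (y, x) = ?F p" by simp
      moreover have "p \<in> ?V \<times> ?V" "(y, x) \<in> ?V \<times> ?V" using p xy C A'(5) by blast+
      ultimately have "(y, x) = p" using inj_onD[OF injF, of "(y, x)" p] by blast
      then show "(y, x) \<in> C" using p by simp
    qed
  qed
  have symsub: "symsub (parcs (fst B)) = image ?F ` symsub ?S"
  proof (intro equalityI subsetI)
    fix C assume C: "C \<in> symsub (parcs (fst B))"
    then obtain D where D: "D \<subseteq> ?S" "C = ?F ` D"
      unfolding symsub_def f(3) by (auto simp: subset_image_iff)
    then show "C \<in> image ?F ` symsub ?S" using C symF[OF D(1)] by (auto simp: symsub_def)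
  next
    fix C assume "C \<in> image ?F ` symsub ?S"
    then show "C \<in> symsub (parcs (fst B))" using symF by (auto simp: symsub_def f(3))
  qed
  have inj_img: "inj_on (image ?F) (symsub ?S)"
    using inj_on_image_Pow[OF injS] by (rule inj_on_subset) (auto simp: symsub_def)
  have sub: "C \<subseteq> ?S" if "C \<in> symsub ?S" for C using that by (simp add: symsub_def)
  have part: "part_fun (fst B) t = part_fun (fst A) t" for t
    unfolding part_fun_def symsub sum.reindex[OF inj_img]
    by (intro sum.cong) (auto simp: weight card sub)
  have arc: "arc_fun (fst B) (?F e) t = arc_fun (fst A) e t" if e: "e \<in> ?S" for e t
  proof -
    have mem: "?F e \<in> ?F ` C \<longleftrightarrow> e \<in> C" if "C \<subseteq> ?S" for C
      using inj_on_image_mem_iff[OF injS e that] .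
    have "{C \<in> symsub (parcs (fst B)). ?F e \<in> C} = image ?F ` {C \<in> symsub ?S. e \<in> C}"
    proof -
      have "{C \<in> image ?F ` symsub ?S. ?F e \<in> C} = image ?F ` {C \<in> symsub ?S. ?F e \<in> ?F ` C}"
        by (rule Compr_image_eq)
      also have "{C \<in> symsub ?S. ?F e \<in> ?F ` C} = {C \<in> symsub ?S. e \<in> C}"
        by (intro Collect_cong conj_cong refl mem sub)
      finally show ?thesis unfolding symsub .
    qed
    moreover have "inj_on (image ?F) {C \<in> symsub ?S. e \<in> C}"
      using inj_img by (rule inj_on_subset) auto
    ultimately show ?thesis
      unfolding arc_fun_def by (simp add: sum.reindex weight card sub)
  qed
  have integrand: "arc_integrand (fst B) (?F e) = arc_integrand (fst A) e" if "e \<in> ?S" for e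
    using that by (auto simp: arc_integrand_def part arc)
  have "outs (parcs (fst B)) (snd B) = ?F ` outs ?S (snd A)"
    unfolding f(3,4) using root by (intro outs) auto
  moreover have "inj_on ?F (outs ?S (snd A))" using injS outs_subset by (rule inj_on_subset)
  ultimately have "(\<Sum>e\<in>outs (parcs (fst B)) (snd B). integral {0..z} (arc_integrand (fst B) e)) =
      (\<Sum>e\<in>outs ?S (snd A). integral {0..z} (arc_integrand (fst A) e))"
    using outs_subset[of ?S "snd A"]
    by (simp only: sum.reindex o_def) (rule sum.cong[OF refl], simp only: integrand subsetD)
  then show ?thesis using deg[OF root] f(4) by (simp add: root_term_def)
qed

section \<open>Types of balls\<close>

text \<open>Equality of types can be tested on a single representative; this links types to
  \<open>ball_prob\<close>, which tests against one graph.\<close>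

lemma ball_type_eq_iff:
  assumes "pair_graph G" "v \<in> pverts G" "pair_graph G'" "v' \<in> pverts G'"
    and "A \<in> ball_type G' r v'"
  shows "ball_type G r v = ball_type G' r v' \<longleftrightarrow> rooted_iso (rooted_ball G r v) A"
proof
  let ?B = "rooted_ball G r v" and ?B' = "rooted_ball G' r v'"
  assume iso: "rooted_iso ?B A"
  have B: "root_graph ?B" "root_graph ?B'" by (simp_all add: assms root_graph_rooted_ball)
  have "rooted_iso A ?B'"
    using assms(5) by (intro rooted_iso_sym[OF B(2)]) (simp add: ball_type_def)
  then have 1: "rooted_iso ?B ?B'" by (rule rooted_iso_trans[OF B(1) iso])
  have 2: "rooted_iso ?B' ?B" using B(1) 1 by (rule rooted_iso_sym)
  have "rooted_iso ?B C \<longleftrightarrow> rooted_iso ?B' C" for C :: "nat rooted_graph"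
    using rooted_iso_trans[OF B(1) 1] rooted_iso_trans[OF B(2) 2] by blast
  then show "ball_type G r v = ball_type G' r v'" by (auto simp: ball_type_def)
qed (use assms(5) in \<open>auto simp: ball_type_def\<close>)

lemma ex_initial_segment_iso:
  assumes A: "root_graph A"
  obtains B :: "nat rooted_graph"
  where "rooted_iso A B" "pverts (fst B) = {..<card (pverts (fst A))}"
proof -
  have fin: "finite (pverts (fst A))" and gA: "pair_graph (fst A)"
    using A pair_graph_arcs(1) by (auto simp: root_graph_def)
  then obtain f where f: "bij_betw f (pverts (fst A)) {..<card (pverts (fst A))}"
    using ex_bij_betw_finite_nat[OF fin] by (auto simp: atLeast0LessThan)
  let ?B = "(\<lparr>pverts = f ` pverts (fst A), parcs = map_prod f f ` parcs (fst A)\<rparr>, f (snd A))"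
  have "rooted_iso A ?B"
    using f by (intro rooted_isoI[where f = f] gA) (auto simp: bij_betw_def)
  then show thesis using that f by (auto simp: bij_betw_def)
qed

lemma ball_type_nonempty:
  assumes "pair_graph G" "v \<in> pverts G"
  shows "ball_type G r v \<noteq> {}"
  using ex_initial_segment_iso[OF root_graph_rooted_ball[OF assms], of r]
  unfolding ball_type_def by blast

text \<open>For a ball type the choice of representative is immaterial by
  \<open>root_term_iso\<close>.\<close>

definition type_term :: "real \<Rightarrow> nat rooted_graph set \<Rightarrow> real" where
  "type_term z T = root_term z (SOME A. A \<in> T)"

lemma type_term_ball_type:
  assumes "pair_graph G" "v \<in> pverts G"
  shows "type_term z (ball_type G r v) = root_term z (rooted_ball G r v)"
proof -
  have "(SOME A. A \<in> ball_type G r v) \<in> ball_type G r v"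
    using ball_type_nonempty[OF assms] by (simp add: some_in_eq)
  then show ?thesis
    unfolding type_term_def using root_graph_rooted_ball[OF assms]
    by (intro root_term_iso) (auto simp: ball_type_def)
qed

lemma card_ball_verts_le:
  assumes G: "pair_graph G" "v \<in> pverts G" and deg: "max_degree_le \<Delta> G"
  shows "card (ball_verts G r v) \<le> (\<Delta> + 1) ^ r"
proof (induction r)
  case 0
  have "ball_verts G 0 v = {v}" using G by (auto simp: ball_verts_eq)
  then show ?case by simp
next
  case (Suc r)
  note G' = pair_graph_arcs[OF G(1)]
  have fin: "finite (ball_verts G r v)" using ball_verts_subset[OF G(1)] G'(1) by (rule finite_subset)
  have "ball_verts G (Suc r) v \<subseteq> (\<Union>x\<in>ball_verts G r v. insert x (snd ` outs (parcs G) x))"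
  proof
    fix y assume "y \<in> ball_verts G (Suc r) v"
    then obtain k where k: "k \<le> Suc r" "(v, y) \<in> parcs G ^^ k" using G by (auto simp: ball_verts_eq)
    show "y \<in> (\<Union>x\<in>ball_verts G r v. insert x (snd ` outs (parcs G) x))"
    proof (cases "k \<le> r")
      case True
      then show ?thesis using k G by (auto simp: ball_verts_eq)
    next
      case False
      then have "k = Suc r" using k by simp
      then obtain x where x: "(v, x) \<in> parcs G ^^ r" "(x, y) \<in> parcs G" using k by auto
      then have "x \<in> ball_verts G r v" "y \<in> snd ` outs (parcs G) x"
        using G by (force simp: ball_verts_eq outs_def)+
      then show ?thesis by blast
    qed
  qed
  then have "card (ball_verts G (Suc r) v) \<le>
      card (\<Union>x\<in>ball_verts G r v. insert x (snd ` outs (parcs G) x))"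
    using fin G' by (intro card_mono) auto
  also have "\<dots> \<le> (\<Sum>x\<in>ball_verts G r v. card (insert x (snd ` outs (parcs G) x)))"
    using fin by (rule card_UN_le)
  also have "\<dots> \<le> (\<Sum>x\<in>ball_verts G r v. \<Delta> + 1)"
  proof (rule sum_mono)
    fix x assume "x \<in> ball_verts G r v"
    then have "deg G x \<le> \<Delta>"
      using deg ball_verts_subset[OF G(1)] by (auto simp: max_degree_le_def deg_eq_out_degree)
    moreover have "card (snd ` outs (parcs G) x) \<le> deg G x"
      unfolding deg_def using G' by (intro card_image_le) auto
    ultimately show "card (insert x (snd ` outs (parcs G) x)) \<le> \<Delta> + 1"
      using G'(2) by (simp add: card_insert_if)
  qed
  also have "\<dots> \<le> (\<Delta> + 1) ^ Suc r" using mult_le_mono1[OF Suc.IH, of "\<Delta> + 1"] by (simp add: mult.commute)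
  finally show ?case .
qed

text \<open>A ball has at most \<open>(\<Delta> + 1) ^ r\<close> vertices, so its type is the class
  of a graph on an initial segment of bounded length, and there are finitely many of those.\<close>

lemma finite_ball_types:
  "finite {ball_type G r v | (G :: 'a pair_pre_digraph) v.
     pair_graph G \<and> max_degree_le \<Delta> G \<and> v \<in> pverts G}" (is "finite ?T")
proof (rule finite_subset)
  define N where "N = (\<Delta> + 1) ^ r"
  define \<A> where "\<A> = (\<lambda>(n, S, o'). (\<lparr>pverts = {..<n}, parcs = S\<rparr>, o')) `
    ({..N} \<times> Pow ({..<N} \<times> {..<N}) \<times> {..<N})"
  show "finite ((\<lambda>A. {B :: nat rooted_graph. rooted_iso A B}) ` \<A>)"
    unfolding \<A>_def by (intro finite_imageI finite_cartesian_product) auto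
  show "?T \<subseteq> (\<lambda>A. {B. rooted_iso A B}) ` \<A>"
  proof
    fix T assume "T \<in> ?T"
    then obtain G :: "'a pair_pre_digraph" and v where
      G: "pair_graph G" "max_degree_le \<Delta> G" "v \<in> pverts G" and T: "T = ball_type G r v" by auto
    have ball: "root_graph (rooted_ball G r v)" using G by (intro root_graph_rooted_ball)
    then obtain A :: "nat rooted_graph" where A: "rooted_iso (rooted_ball G r v) A"
      "pverts (fst A) = {..<card (ball_verts G r v)}"
      by (rule ex_initial_segment_iso) auto
    have rA: "root_graph A" using ball A(1) by (rule root_graph_iso)
    have n: "card (ball_verts G r v) \<le> N" unfolding N_def using G by (intro card_ball_verts_le)
    have "parcs (fst A) \<subseteq> pverts (fst A) \<times> pverts (fst A)" "snd A \<in> pverts (fst A)"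
      using rA pair_graph_arcs(5) by (auto simp: root_graph_def)
    then have "parcs (fst A) \<subseteq> {..<N} \<times> {..<N}" "snd A \<in> {..<N}" using n A(2) by auto
    then have "A \<in> \<A>"
      unfolding \<A>_def using n A(2)
      by (intro image_eqI[of _ _ "(card (ball_verts G r v), parcs (fst A), snd A)"]) (auto intro!: prod_eqI)
    moreover have "T = {B. rooted_iso A B}"
      unfolding T ball_type_def
      using rooted_iso_trans[OF ball A(1)] rooted_iso_trans[OF rA rooted_iso_sym[OF ball A(1)]] by blast
    ultimately show "T \<in> (\<lambda>A. {B. rooted_iso A B}) ` \<A>" by blast
  qed
qed

lemma connected_rooted_ball:
  assumes G: "pair_graph G" "v \<in> pverts G"
  shows "Digraph_Component.connected (with_proj (fst (rooted_ball G r v)))"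
proof -
  let ?H = "fst (rooted_ball G r v)"
  let ?M = "with_proj (mk_symmetric (with_proj ?H))"
  have M: "verts ?M = ball_verts G r v" "parcs ?H \<subseteq> arcs_ends ?M"
    by (auto simp: mk_symmetric_def)
  \<comment> \<open>All vertices on a walk of length at most \<open>r\<close> from the centre lie in
    the ball, so the walk survives in the induced graph.\<close>
  have "v \<rightarrow>\<^sup>*\<^bsub>?M\<^esub> x" if "(v, x) \<in> parcs G ^^ k" "k \<le> r" for k x
    using that
  proof (induction k arbitrary: x)
    case 0
    then show ?case using ball_verts_root[OF G] M by (simp add: reachable_def)
  next
    case (Suc k)
    then obtain y where y: "(v, y) \<in> parcs G ^^ k" "(y, x) \<in> parcs G" by auto
    have "y \<in> ball_verts G r v" "x \<in> ball_verts G r v"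
      using y Suc.prems unfolding ball_verts_eq[OF G] using Suc_leD by blast+
    then have "(y, x) \<in> arcs_ends ?M" "x \<in> verts ?M" using y M by auto
    then show ?case using Suc.IH[OF y(1)] Suc.prems(2)
      unfolding reachable_def by (meson Suc_leD rtrancl_on_into_rtrancl_on)
  qed
  then have reach: "v \<rightarrow>\<^sup>*\<^bsub>?M\<^esub> x" if "x \<in> verts ?M" for x
    using that M ball_verts_eq[OF G] by auto
  have sym: "symmetric ?M" by (rule symmetric_mk_symmetric)
  have "x \<rightarrow>\<^sup>*\<^bsub>?M\<^esub> y" if "x \<in> verts ?M" "y \<in> verts ?M" for x y
  proof -
    have "x \<rightarrow>\<^sup>*\<^bsub>?M\<^esub> v" using sym reach[OF that(1)] by (rule symmetric_reachable)
    then show ?thesis using reach[OF that(2)] unfolding reachable_def by (rule rtrancl_on_trans)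
  qed
  moreover have "verts ?M \<noteq> {}" using ball_verts_root[OF G] M by auto
  ultimately show ?thesis unfolding Digraph_Component.connected_def by (intro strongly_connectedI) auto
qed

text \<open>Convergence is assumed only for connected test graphs, so representatives of ball types
  have to be recognised as such.\<close>

lemma finite_connected_ball_type:
  assumes G: "pair_graph G" "v \<in> pverts G" and A: "A \<in> ball_type G r v"
  shows "finite_connected_rooted_graph A"
proof -
  have ball: "root_graph (rooted_ball G r v)" using G by (intro root_graph_rooted_ball)
  have iso: "rooted_iso (rooted_ball G r v) A" using A by (simp add: ball_type_def)
  then have rA: "root_graph A" using root_graph_iso ball by blast
  obtain h where h: "pre_digraph.digraph_isomorphism (with_proj (fst (rooted_ball G r v))) h"
    "with_proj (fst A) = app_iso h (with_proj (fst (rooted_ball G r v)))"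
    using iso by (auto simp: rooted_iso_def)
  interpret pair_graph "fst (rooted_ball G r v)" using ball by (simp add: root_graph_def)
  have "Digraph_Component.connected (with_proj (fst A))"
    unfolding h(2) using connected_rooted_ball[OF G] h(1) by (rule connectedI_app_iso)
  then show ?thesis
    using rA by (auto simp: finite_connected_rooted_graph_def finite_graph_def root_graph_def)
qed

section \<open>Sampling\<close>

lemma finite_set_replicate_pmf: "finite (set_pmf p) \<Longrightarrow> finite (set_pmf (replicate_pmf k p))"
  using finite_lists_length_eq[of "set_pmf p" k]
  by (simp add: set_replicate_pmf lists_eq_set)

lemma expectation_replicate_pmf_Suc:
  fixes f :: "'b list \<Rightarrow> real"
  assumes "finite (set_pmf p)"
  shows "measure_pmf.expectation (replicate_pmf (Suc k) p) f =
    measure_pmf.expectation p (\<lambda>x. measure_pmf.expectation (replicate_pmf k p) (\<lambda>xs. f (x # xs)))"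
proof -
  have "replicate_pmf (Suc k) p = p \<bind> (\<lambda>x. map_pmf ((#) x) (replicate_pmf k p))"
    by (simp add: map_pmf_def)
  then show ?thesis
    using assms finite_set_replicate_pmf[OF assms, of k]
    by (simp only:) (subst pmf_expectation_bind[of "set_pmf p"], simp_all add: integral_measure_pmf[of "set_pmf p"])
qed

text \<open>The samples are independent and centred, so the mixed term in the square of the sum has
  expectation zero.\<close>

lemma replicate_pmf_moments:
  fixes Y :: "'b \<Rightarrow> real"
  assumes fin: "finite (set_pmf p)" and Y: "measure_pmf.expectation p Y = 0"
  shows "measure_pmf.expectation (replicate_pmf k p) (\<lambda>xs. sum_list (map Y xs)) = 0"
    "measure_pmf.expectation (replicate_pmf k p) (\<lambda>xs. (sum_list (map Y xs))\<^sup>2) =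
      real k * measure_pmf.expectation p (\<lambda>x. (Y x)\<^sup>2)"
proof (induction k)
  case (Suc k)
  let ?E = "measure_pmf.expectation p" and ?R = "measure_pmf.expectation (replicate_pmf k p)"
  let ?S = "\<lambda>xs. sum_list (map Y xs)"
  have int: "integrable (measure_pmf p) f" "integrable (measure_pmf (replicate_pmf k p)) g"
    for f :: "'b \<Rightarrow> real" and g :: "'b list \<Rightarrow> real"
    using fin finite_set_replicate_pmf by (auto intro: integrable_measure_pmf_finite)
  have "?R (\<lambda>xs. Y x + ?S xs) = Y x" for x
    using Suc.IH(1) by (simp add: int)
  then show "measure_pmf.expectation (replicate_pmf (Suc k) p) ?S = 0"
    using Y by (subst expectation_replicate_pmf_Suc[OF fin]) simp
  have "?R (\<lambda>xs. (Y x + ?S xs)\<^sup>2) = (Y x)\<^sup>2 + real k * ?E (\<lambda>x. (Y x)\<^sup>2)" for x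
  proof -
    have "?R (\<lambda>xs. (Y x + ?S xs)\<^sup>2) = ?R (\<lambda>xs. (Y x)\<^sup>2 + (2 * Y x) * ?S xs + (?S xs)\<^sup>2)"
      by (simp add: power2_sum algebra_simps)
    also have "\<dots> = (Y x)\<^sup>2 + (2 * Y x) * ?R ?S + ?R (\<lambda>xs. (?S xs)\<^sup>2)"
      by (simp add: int del: sum_list.Cons)
    finally show ?thesis using Suc.IH by simp
  qed
  then show "measure_pmf.expectation (replicate_pmf (Suc k) p) (\<lambda>xs. (?S xs)\<^sup>2) =
      real (Suc k) * ?E (\<lambda>x. (Y x)\<^sup>2)"
    by (subst expectation_replicate_pmf_Suc[OF fin]) (simp add: int algebra_simps)
qed simp_all

text \<open>Chebyshev's inequality; the variance is at most \<open>(2 * C)\<^sup>2\<close> because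
  both \<open>X\<close> and its mean are bounded by \<open>C\<close>.\<close>

lemma sample_mean_concentration:
  fixes X :: "'b \<Rightarrow> real"
  assumes fin: "finite (set_pmf p)" and X: "\<And>x. x \<in> set_pmf p \<Longrightarrow> \<bar>X x\<bar> \<le> C"
    and k: "0 < k" and \<delta>: "0 < \<delta>"
  shows "measure_pmf.prob (replicate_pmf k p)
      {xs. \<delta> \<le> \<bar>sum_list (map X xs) / real k - measure_pmf.expectation p X\<bar>} \<le>
    (2 * C)\<^sup>2 / (real k * \<delta>\<^sup>2)"
proof -
  define \<mu> where "\<mu> = measure_pmf.expectation p X"
  define Y where "Y x = X x - \<mu>" for x
  let ?R = "replicate_pmf k p"
  have int: "integrable (measure_pmf p) f" for f :: "'b \<Rightarrow> real"
    using fin by (rule integrable_measure_pmf_finite)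
  have \<mu>: "\<bar>\<mu>\<bar> \<le> C"
  proof -
    have "\<bar>\<mu>\<bar> \<le> measure_pmf.expectation p (\<lambda>x. \<bar>X x\<bar>)" unfolding \<mu>_def by (rule integral_abs_bound)
    also have "\<dots> \<le> measure_pmf.expectation p (\<lambda>_. C)"
      using X by (intro integral_mono_AE int) (auto simp: AE_measure_pmf_iff)
    finally show ?thesis by simp
  qed
  have EY: "measure_pmf.expectation p Y = 0" by (simp add: Y_def[abs_def] \<mu>_def int)
  have "measure_pmf.expectation p (\<lambda>x. (Y x)\<^sup>2) \<le> measure_pmf.expectation p (\<lambda>_. (2 * C)\<^sup>2)"
  proof (intro integral_mono_AE int)
    have "(Y x)\<^sup>2 \<le> (2 * C)\<^sup>2" if "x \<in> set_pmf p" for x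
    proof -
      have "\<bar>Y x\<bar> \<le> 2 * C" using X[OF that] \<mu> by (simp add: Y_def)
      then have "\<bar>Y x\<bar>\<^sup>2 \<le> (2 * C)\<^sup>2" by (intro power_mono) auto
      then show ?thesis by simp
    qed
    then show "AE x in measure_pmf p. (Y x)\<^sup>2 \<le> (2 * C)\<^sup>2" by (auto simp: AE_measure_pmf_iff)
  qed
  then have var: "measure_pmf.expectation p (\<lambda>x. (Y x)\<^sup>2) \<le> (2 * C)\<^sup>2" by simp
  have sumY: "sum_list (map Y xs) = sum_list (map X xs) - real (length xs) * \<mu>" for xs
    by (induction xs) (auto simp: Y_def algebra_simps)
  \<comment> \<open>Restricting to the support gives \<open>length xs = k\<close>, which relates the
    sums of \<open>X\<close> and \<open>Y\<close>.\<close>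
  have "measure_pmf.prob ?R {xs. \<delta> \<le> \<bar>sum_list (map X xs) / real k - \<mu>\<bar>} =
      measure_pmf.prob ?R ({xs. \<delta> \<le> \<bar>sum_list (map X xs) / real k - \<mu>\<bar>} \<inter> set_pmf ?R)"
    by (simp add: measure_Int_set_pmf)
  also have "\<dots> \<le> measure_pmf.prob ?R {xs. (real k * \<delta>)\<^sup>2 \<le> (sum_list (map Y xs))\<^sup>2}"
  proof (rule measure_pmf.finite_measure_mono)
    show "{xs. \<delta> \<le> \<bar>sum_list (map X xs) / real k - \<mu>\<bar>} \<inter> set_pmf ?R \<subseteq>
        {xs. (real k * \<delta>)\<^sup>2 \<le> (sum_list (map Y xs))\<^sup>2}"
    proof safe
      fix xs assume xs: "xs \<in> set_pmf ?R" and le: "\<delta> \<le> \<bar>sum_list (map X xs) / real k - \<mu>\<bar>"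
      have "length xs = k" using xs by (simp add: set_replicate_pmf)
      then have "sum_list (map X xs) / real k - \<mu> = sum_list (map Y xs) / real k"
        using k by (simp add: sumY field_simps)
      then have "real k * \<delta> \<le> \<bar>sum_list (map Y xs)\<bar>" using le k by (simp add: field_simps)
      then have "(real k * \<delta>)\<^sup>2 \<le> \<bar>sum_list (map Y xs)\<bar>\<^sup>2" using \<delta> by (intro power_mono) auto
      then show "(real k * \<delta>)\<^sup>2 \<le> (sum_list (map Y xs))\<^sup>2" by simp
    qed
  qed auto
  also have "\<dots> \<le> measure_pmf.expectation ?R (\<lambda>xs. (sum_list (map Y xs))\<^sup>2) / (real k * \<delta>)\<^sup>2"
    using integral_Markov_inequality_measure[of "measure_pmf ?R" "\<lambda>xs. (sum_list (map Y xs))\<^sup>2" "{}"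
      "(real k * \<delta>)\<^sup>2"] k \<delta> finite_set_replicate_pmf[OF fin]
    by (simp add: integrable_measure_pmf_finite)
  also have "\<dots> = real k * measure_pmf.expectation p (\<lambda>x. (Y x)\<^sup>2) / (real k * \<delta>)\<^sup>2"
    by (simp only: replicate_pmf_moments(2)[OF fin EY])
  also have "\<dots> \<le> real k * (2 * C)\<^sup>2 / (real k * \<delta>)\<^sup>2"
    using var by (intro divide_right_mono mult_left_mono) auto
  also have "\<dots> = (2 * C)\<^sup>2 / (real k * \<delta>\<^sup>2)" using k by (simp add: power2_eq_square)
  finally show ?thesis by (simp add: \<mu>_def)
qed

section \<open>Estimability and convergence\<close>

text \<open>The order of choices matters: \<open>z\<close> depends on \<delta> and \<Delta>, the
  radius \<rho> lies midway between \<open>z\<close> and 1, and \<open>r\<close> is chosen last so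
  that the power of \<open>z / \<rho>\<close> absorbs the constant depending on \<rho>.\<close>

lemma ball_type_average:
  assumes \<delta>: "0 < \<delta>"
  obtains r z C where "0 < r"
    "\<And>G :: 'a pair_pre_digraph. eulerian_graph G \<Longrightarrow> max_degree_le \<Delta> G \<Longrightarrow>
      \<bar>eulerian_entropy G - (\<Sum>v\<in>pverts G. type_term z (ball_type G r v)) / real (card (pverts G))\<bar> \<le> \<delta>"
    "\<And>(G :: 'a pair_pre_digraph) v. eulerian_graph G \<Longrightarrow> max_degree_le \<Delta> G \<Longrightarrow> v \<in> pverts G \<Longrightarrow>
      \<bar>type_term z (ball_type G r v)\<bar> \<le> C"
proof -
  \<comment> \<open>This makes \<open>(real \<Delta> + 1) * ln (1 / z)\<close> equal to half of
    \<delta>; adding 1 avoids division by zero for \<Delta> = 0.\<close>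
  define z where "z = exp (- \<delta> / (2 * (real \<Delta> + 1)))"
  have z: "0 < z" "z < 1" using \<delta> by (auto simp: z_def)
  define \<rho> where "\<rho> = (1 + z) / 2"
  have \<rho>: "z < \<rho>" "\<rho> < 1" using z by (auto simp: \<rho>_def)
  have \<rho>2: "\<rho>\<^sup>2 < 1" using z \<rho> by (simp add: abs_square_less_1)
  have "ln (1 / z) = \<delta> / (2 * (real \<Delta> + 1))" by (simp add: z_def ln_div)
  then have "(real \<Delta> + 1) * ln (1 / z) = \<delta> / 2" by (simp add: field_simps)
  moreover have "0 \<le> ln (1 / z)" using z by simp
  ultimately have half: "real \<Delta> * ln (1 / z) \<le> \<delta> / 2" by (simp only: distrib_right mult_1)
  define D where "D = real \<Delta> * (2 / (1 - \<rho>\<^sup>2)) + 1"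
  have D: "D > 0" unfolding D_def using \<rho>2 by (intro add_nonneg_pos) auto
  obtain r where "(z / \<rho>) ^ r < \<delta> / 2 / D"
    using real_arch_pow_inv[of "\<delta> / 2 / D" "z / \<rho>"] \<delta> D z \<rho> by auto
  then have "(z / \<rho>) ^ r * D < \<delta> / 2" using D by (simp add: field_simps)
  moreover have "(z / \<rho>) ^ r * (D - 1) \<le> (z / \<rho>) ^ r * D"
    using z \<rho> by (intro mult_left_mono) auto
  ultimately have "real \<Delta> * ((z / \<rho>) ^ r * (2 / (1 - \<rho>\<^sup>2))) \<le> \<delta> / 2" by (simp add: D_def mult_ac)
  then have small: "real \<Delta> * (ln (1 / z) + (z / \<rho>) ^ r * (2 / (1 - \<rho>\<^sup>2))) \<le> \<delta>"
    using half unfolding distrib_left by linarith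
  show thesis
  proof (rule that[of "Suc r" z "real \<Delta> * (1 / (1 - z\<^sup>2)) + real \<Delta> * ln 2"])
    fix G :: "'a pair_pre_digraph" assume G: "eulerian_graph G" "max_degree_le \<Delta> G"
    interpret eulerian G using G(1) by unfold_locales
    have eq: "type_term z (ball_type G (Suc r) v) = root_term z (rooted_ball G (Suc r) v)"
      if "v \<in> pverts G" for v
      using pair_graph that by (rule type_term_ball_type)
    show "\<bar>eulerian_entropy G - (\<Sum>v\<in>pverts G. type_term z (ball_type G (Suc r) v)) / real (card (pverts G))\<bar> \<le> \<delta>"
      using root_term_approx[OF G(2) z(1) \<rho>, of r] small by (simp add: eq)
    fix v assume v: "v \<in> pverts G"
    show "\<bar>type_term z (ball_type G (Suc r) v)\<bar> \<le> real \<Delta> * (1 / (1 - z\<^sup>2)) + real \<Delta> * ln 2"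
      unfolding eq[OF v]
    proof (rule abs_root_term_le)
      show "pair_graph (fst (rooted_ball G (Suc r) v))" using pair_graph by (rule pair_graph_rooted_ball)
      show "deg (fst (rooted_ball G (Suc r) v)) (snd (rooted_ball G (Suc r) v)) \<le> \<Delta>"
        using deg_rooted_ball[OF pair_graph v ball_verts_root[OF pair_graph v]] G(2) v
        by (simp add: max_degree_le_def deg_eq_out_degree del: rooted_ball_simps(3))
    qed (use z in auto)
  qed simp
qed

lemma estimable_eulerian_entropy:
  "estimable {G :: 'a pair_pre_digraph. eulerian_graph G \<and> max_degree_le \<Delta> G} eulerian_entropy"
  unfolding estimable_def
proof (intro conjI allI impI)
  let ?\<C> = "{G :: 'a pair_pre_digraph. eulerian_graph G \<and> max_degree_le \<Delta> G}"
  \<comment> \<open>Accuracy 1 suffices for boundedness: the entropy is within 1 of an average of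
    terms bounded by \<open>C\<close>.\<close>
  from zero_less_one obtain r z C where C: "0 < r"
    "\<And>G :: 'a pair_pre_digraph. eulerian_graph G \<Longrightarrow> max_degree_le \<Delta> G \<Longrightarrow>
      \<bar>eulerian_entropy G - (\<Sum>v\<in>pverts G. type_term z (ball_type G r v)) / real (card (pverts G))\<bar> \<le> 1"
    "\<And>(G :: 'a pair_pre_digraph) v. eulerian_graph G \<Longrightarrow> max_degree_le \<Delta> G \<Longrightarrow> v \<in> pverts G \<Longrightarrow>
      \<bar>type_term z (ball_type G r v)\<bar> \<le> C"
    by (rule ball_type_average[where \<Delta> = \<Delta>]) blast
  have "\<bar>eulerian_entropy G\<bar> \<le> 1 + C" if "eulerian_graph G" "max_degree_le \<Delta> G" for G :: "'a pair_pre_digraph"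
  proof -
    interpret eulerian G using that(1) by unfold_locales
    have N: "real (card (pverts G)) > 0" using arcs nonempty by (simp add: card_gt_0_iff)
    have "\<bar>\<Sum>v\<in>pverts G. type_term z (ball_type G r v)\<bar> \<le> real (card (pverts G)) * C"
      using C(3)[OF that] by (intro order_trans[OF sum_abs] sum_bounded_above)
    then have "\<bar>(\<Sum>v\<in>pverts G. type_term z (ball_type G r v)) / real (card (pverts G))\<bar> \<le> C"
      using N by (simp add: pos_divide_le_eq mult.commute)
    then show ?thesis using C(2)[OF that] by linarith
  qed
  then show "\<exists>B. \<forall>G\<in>?\<C>. \<bar>eulerian_entropy G\<bar> \<le> B" by blast
next
  let ?\<C> = "{G :: 'a pair_pre_digraph. eulerian_graph G \<and> max_degree_le \<Delta> G}"
  fix \<delta> :: real assume \<delta>: "0 < \<delta>"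
  from half_gt_zero[OF \<delta>] obtain r z C where r: "0 < r" and approx:
    "\<And>G :: 'a pair_pre_digraph. eulerian_graph G \<Longrightarrow> max_degree_le \<Delta> G \<Longrightarrow>
      \<bar>eulerian_entropy G - (\<Sum>v\<in>pverts G. type_term z (ball_type G r v)) / real (card (pverts G))\<bar> \<le> \<delta> / 2"
    and C: "\<And>(G :: 'a pair_pre_digraph) v. eulerian_graph G \<Longrightarrow> max_degree_le \<Delta> G \<Longrightarrow> v \<in> pverts G \<Longrightarrow>
      \<bar>type_term z (ball_type G r v)\<bar> \<le> C"
    by (rule ball_type_average[where \<Delta> = \<Delta>]) blast
  \<comment> \<open>The sample size is dictated by \<open>sample_mean_concentration\<close> at
    accuracy \<open>\<delta> / 2\<close> with failure probability \<delta>; the other half of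
    \<delta> is spent on the distance from the entropy to the mean.\<close>
  define k where "k = nat \<lceil>(2 * C)\<^sup>2 / ((\<delta> / 2)\<^sup>2 * \<delta>)\<rceil> + 1"
  have k: "0 < k" by (simp add: k_def)
  have "(2 * C)\<^sup>2 / ((\<delta> / 2)\<^sup>2 * \<delta>) \<le> real k" unfolding k_def by linarith
  then have k_le: "(2 * C)\<^sup>2 / (real k * (\<delta> / 2)\<^sup>2) \<le> \<delta>"
    using \<delta> k by (simp add: field_simps)
  define g where "g Ts = sum_list (map (type_term z) Ts) / real k" for Ts
  have "measure_pmf.prob (replicate_pmf k (pmf_of_set (pverts G)))
      {vs. \<bar>eulerian_entropy G - g (map (ball_type G r) vs)\<bar> > \<delta>} \<le> \<delta>" if G: "G \<in> ?\<C>" for G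
  proof -
    have G: "eulerian_graph G" "max_degree_le \<Delta> G" using G by auto
    interpret eulerian G using G(1) by unfold_locales
    let ?p = "pmf_of_set (pverts G)"
    define X where "X v = type_term z (ball_type G r v)" for v
    have p: "set_pmf ?p = pverts G" using arcs nonempty by simp
    have mean: "measure_pmf.expectation ?p X = (\<Sum>v\<in>pverts G. X v) / real (card (pverts G))"
      using arcs nonempty by (intro integral_pmf_of_set)
    have g: "g (map (ball_type G r) vs) = sum_list (map X vs) / real k" for vs
      by (simp add: g_def X_def[abs_def] o_def)
    have "measure_pmf.prob (replicate_pmf k ?p) {vs. \<bar>eulerian_entropy G - g (map (ball_type G r) vs)\<bar> > \<delta>} \<le>
        measure_pmf.prob (replicate_pmf k ?p)
          {vs. \<delta> / 2 \<le> \<bar>sum_list (map X vs) / real k - measure_pmf.expectation ?p X\<bar>}"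
    proof (rule measure_pmf.finite_measure_mono)
      have "\<bar>eulerian_entropy G - measure_pmf.expectation ?p X\<bar> \<le> \<delta> / 2"
        unfolding mean X_def using approx[OF G] .
      then show "{vs. \<bar>eulerian_entropy G - g (map (ball_type G r) vs)\<bar> > \<delta>} \<subseteq>
          {vs. \<delta> / 2 \<le> \<bar>sum_list (map X vs) / real k - measure_pmf.expectation ?p X\<bar>}"
        unfolding g by (intro Collect_mono impI) linarith
    qed auto
    also have "\<dots> \<le> (2 * C)\<^sup>2 / (real k * (\<delta> / 2)\<^sup>2)"
      using k \<delta> C[OF G] arcs p by (intro sample_mean_concentration) (auto simp: X_def)
    also have "\<dots> \<le> \<delta>" by (rule k_le)
    finally show ?thesis .
  qed
  then show "\<exists>k>0. \<exists>r>0. \<exists>g. \<forall>G\<in>?\<C>. measure_pmf.prob (replicate_pmf k (pmf_of_set (pverts G)))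
      {vs. \<delta> < \<bar>eulerian_entropy G - g (map (ball_type G r) vs)\<bar>} \<le> \<delta>"
    using k r by blast
qed

text \<open>Over a finite set of types that does not depend on \<open>n\<close>, the average is a
  linear combination of the probabilities \<open>ball_prob\<close> with coefficients independent of
  \<open>n\<close>.\<close>

lemma convergent_type_average:
  fixes G :: "nat \<Rightarrow> 'a pair_pre_digraph"
  assumes BS: "BS_convergent G" and deg: "\<And>n. max_degree_le \<Delta> (G n)" and r: "0 < r"
  shows "convergent (\<lambda>n. (\<Sum>v\<in>pverts (G n). type_term z (ball_type (G n) r v)) / real (card (pverts (G n))))"
proof -
  define \<T> where "\<T> = {ball_type G r v | (G :: 'a pair_pre_digraph) v.
     pair_graph G \<and> max_degree_le \<Delta> G \<and> v \<in> pverts G}"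
  have fin: "finite \<T>" unfolding \<T>_def by (rule finite_ball_types)
  define rep :: "nat rooted_graph set \<Rightarrow> nat rooted_graph" where "rep T = (SOME A. A \<in> T)" for T
  have G: "pair_graph (G n)" "pverts (G n) \<noteq> {}" for n
    using BS by (auto simp: BS_convergent_def finite_graph_def)
  have rep: "rep T \<in> T \<and> finite_connected_rooted_graph (rep T) \<and>
      (\<forall>n. \<forall>v\<in>pverts (G n). ball_type (G n) r v = T \<longleftrightarrow> rooted_iso (rooted_ball (G n) r v) (rep T))"
    if T: "T \<in> \<T>" for T
  proof -
    obtain H :: "'a pair_pre_digraph" and w where H: "pair_graph H" "w \<in> pverts H" "T = ball_type H r w"
      using T unfolding \<T>_def by blast
    have "rep T \<in> T" unfolding rep_def using ball_type_nonempty[OF H(1,2)] H(3) by (simp add: some_in_eq)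
    then show ?thesis
      using ball_type_eq_iff[OF G(1) _ H(1,2)] finite_connected_ball_type[OF H(1,2)] unfolding H(3) by blast
  qed
  have "(\<Sum>v\<in>pverts (G n). type_term z (ball_type (G n) r v)) / real (card (pverts (G n))) =
      (\<Sum>T\<in>\<T>. type_term z T * ball_prob (G n) (rep T) r)" for n
  proof -
    let ?V = "pverts (G n)"
    have finV: "finite ?V" using pair_graph_arcs(1)[OF G(1)] .
    have sub: "ball_type (G n) r ` ?V \<subseteq> \<T>" using G(1) deg by (auto simp: \<T>_def)
    have "(\<Sum>v\<in>?V. type_term z (ball_type (G n) r v)) =
        (\<Sum>T\<in>\<T>. \<Sum>v | v \<in> ?V \<and> ball_type (G n) r v = T. type_term z (ball_type (G n) r v))"
      by (rule sum.group[OF finV fin sub, symmetric])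
    also have "\<dots> = (\<Sum>T\<in>\<T>. type_term z T * real (card {v \<in> ?V. ball_type (G n) r v = T}))"
      by (intro sum.cong) auto
    also have "\<dots> / real (card ?V) = (\<Sum>T\<in>\<T>. type_term z T * ball_prob (G n) (rep T) r)"
      unfolding sum_divide_distrib
    proof (rule sum.cong[OF refl])
      fix T assume T: "T \<in> \<T>"
      have "?V \<inter> {v. rooted_iso (rooted_ball (G n) r v) (rep T)} = {v \<in> ?V. ball_type (G n) r v = T}"
        using rep[OF T] by blast
      then have "ball_prob (G n) (rep T) r = real (card {v \<in> ?V. ball_type (G n) r v = T}) / real (card ?V)"
        unfolding ball_prob_def using measure_pmf_of_set[OF G(2) finV] by simp
      then show "type_term z T * real (card {v \<in> ?V. ball_type (G n) r v = T}) / real (card ?V) =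
          type_term z T * ball_prob (G n) (rep T) r" by simp
    qed
    finally show ?thesis .
  qed
  moreover have "convergent (\<lambda>n. \<Sum>T\<in>\<T>. type_term z T * ball_prob (G n) (rep T) r)"
  proof (intro convergent_sum convergent_mult convergent_const)
    fix T assume "T \<in> \<T>"
    then have "finite_connected_rooted_graph (rep T)" using rep by blast
    then show "convergent (\<lambda>n. ball_prob (G n) (rep T) r)"
      using BS r unfolding BS_convergent_def by blast
  qed
  ultimately show ?thesis by simp
qed

text \<open>The entropies stay within a third of \<epsilon> of a convergent sequence, uniformly in
  \<open>n\<close>, and are therefore Cauchy; the limit is not identified.\<close>

lemma convergent_eulerian_entropy:
  fixes G :: "nat \<Rightarrow> 'a pair_pre_digraph"
  assumes eul: "\<And>n. eulerian_graph (G n)" and BS: "BS_convergent G"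
  shows "convergent (\<lambda>n. eulerian_entropy (G n))"
proof -
  obtain \<Delta> where deg: "\<And>n. max_degree_le \<Delta> (G n)"
    using BS by (auto simp: BS_convergent_def bounded_degree_seq_def)
  have "Cauchy (\<lambda>n. eulerian_entropy (G n))"
  proof (rule metric_CauchyI)
    fix \<epsilon> :: real assume \<epsilon>: "0 < \<epsilon>"
    then have "0 < \<epsilon> / 3" by simp
    then obtain r z C where r: "0 < r" and approx:
      "\<And>G :: 'a pair_pre_digraph. eulerian_graph G \<Longrightarrow> max_degree_le \<Delta> G \<Longrightarrow>
        \<bar>eulerian_entropy G - (\<Sum>v\<in>pverts G. type_term z (ball_type G r v)) / real (card (pverts G))\<bar> \<le> \<epsilon> / 3"
      and "\<And>(G :: 'a pair_pre_digraph) v. eulerian_graph G \<Longrightarrow> max_degree_le \<Delta> G \<Longrightarrow> v \<in> pverts G \<Longrightarrow>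
        \<bar>type_term z (ball_type G r v)\<bar> \<le> C"
      by (rule ball_type_average[where \<Delta> = \<Delta>]) blast
    define a where "a n = (\<Sum>v\<in>pverts (G n). type_term z (ball_type (G n) r v)) / real (card (pverts (G n)))" for n
    have "Cauchy a"
      using convergent_type_average[OF BS deg r, of z] unfolding a_def[abs_def] by (rule convergent_Cauchy)
    then obtain M where M: "\<And>m n. M \<le> m \<Longrightarrow> M \<le> n \<Longrightarrow> dist (a m) (a n) < \<epsilon> / 3"
      using metric_CauchyD[of a "\<epsilon> / 3"] \<epsilon> by (metis divide_pos_pos zero_less_numeral)
    have "dist (eulerian_entropy (G m)) (eulerian_entropy (G n)) < \<epsilon>" if "M \<le> m" "M \<le> n" for m n
      using M[OF that] approx[OF eul deg, of m] approx[OF eul deg, of n]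
      unfolding dist_real_def a_def by linarith
    then show "\<exists>M. \<forall>m\<ge>M. \<forall>n\<ge>M. dist (eulerian_entropy (G m)) (eulerian_entropy (G n)) < \<epsilon>" by blast
  qed
  then show ?thesis by (rule Cauchy_convergent)
qed

theorem theorem1p3:
  shows "(\<forall>\<Delta>. estimable {G :: 'a pair_pre_digraph. eulerian_graph G \<and> max_degree_le \<Delta> G}
               eulerian_entropy) \<and>
         (\<forall>G :: nat \<Rightarrow> 'a pair_pre_digraph.
            (\<forall>n. eulerian_graph (G n)) \<and> BS_convergent G \<longrightarrow>
            (\<exists>L. (\<lambda>n. eulerian_entropy (G n)) \<longlonglongrightarrow> L))"
  using estimable_eulerian_entropy convergent_eulerian_entropy unfolding convergent_def by blast

end
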